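(* Let assumptions (A1)–(A4) and (B) of the context hold, and let $\widetilde\lambda:=\lambda(1+\ell_c)^2$, $\widehat\lambda:=\lambda(1+\widehat\ell_c)^2$, $\tau:=\ell_\varphi L_c+\widehat\lambda+\widetilde\lambda$. Suppose $\rho>\ell_\varphi L_c+\max\{\widetilde\lambda,\widehat\lambda\}$ and $\{\alpha_t\}_{t=0}^T\subset(\rho+\ell_\varphi L_c,+\infty)$. Assume $\min_{z\in\mathcal X}f(z)$ exists and put $\Delta_0:=f_{1/\rho}(z^0)-\min_{z\in\mathcal X}f(z)$. Let $z^0,\dots,z^{T}$ be the iterates of the L-SPL algorithm, and let $t^*\in\{0,\dots,T\}$ be a random index, independent of all samples, with $\mathbb P(t^*=t)=p_t\propto\frac{1}{\alpha_t+\rho-\tau}$. With $\widehat z^{\,t}:=\operatorname{prox}_{f/\rho}(z^t)$, the output $z^{t^*}$ satisfies $$\mathbb E\left\|\widehat z^{\,t^*}-z^{t^*}\right\|\le\sqrt{\frac{4\Delta_0+\sum_{t=0}^T\frac{\rho}{\alpha_t+\rho-\tau}\left[\frac{8\ell_\varphi^2(1+\widehat\ell_c)^2}{m_t(\alpha_t-\widehat\lambda)}+\frac{4\ell_\varphi^2e_1^2(n_t)}{2\rho-\ell_\varphi L_c-\tau}+\frac{2\ell_\varphi^2e_1^2(n_t)}{\alpha_t-\rho-\ell_\varphi L_c}\right]}{\sum_{t=0}^T\frac{\rho(2\rho-\ell_\varphi L_c-\tau)}{\alpha_t+\rho-\tau}}}\,.$$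
   Context: $\|\cdot\|$ is the Euclidean norm for vectors and the induced operator norm for matrices. $\nabla c(z)\in\mathbb R^{\ell\times d}$ is the Jacobian of $c$ at $z$. A function $\phi$ on an open convex set is $\lambda$-weakly convex if $\phi(\cdot)+\frac{\lambda}{2}\|\cdot\|^2$ is convex there. Standing assumptions: (A1) $\mathcal X\subseteq\mathbb R^d$ is nonempty, closed, convex, and contained in an open convex set $\mathcal O\subseteq\mathbb R^d$. (A2) $\varphi:\mathcal O\times\mathbb R^\ell\to\mathbb R$ is $\lambda$-weakly convex ($\lambda\ge0$) and $\ell_\varphi$-Lipschitz continuous. (A3) For a decision $x$, $\xi=c(x)+\varepsilon$, where the distribution of $\varepsilon\in\mathbb R^\ell$ does not depend on $x$, $\mathbb E[\varepsilon]=0$, $\mathbb E\|\varepsilon\|^2<\infty$. $\mathbb P_\xi(x)$ denotes the law of $c(x)+\varepsilon$. (A4) $c:\mathcal O\to\mathbb R^\ell$ is $\ell_c$-Lipschitz and $C^1$-smooth with $L_c$-Lipschitz Jacobian. Objective: $f(x):=\mathbb E[\varphi(x,c(x)+\varepsilon)]$. For $x\in\mathbb R^d$: $f_{1/\rho}(x):=\inf_{y\in\mathcal X}\{f(y)+\frac\rho2\|y-x\|^2\}$ and $\operatorname{prox}_{f/\rho}(x):=\operatorname{argmin}_{y\in\mathcal X}\{f(y)+\frac\rho2\|y-x\|^2\}$. Jacobian estimation. For $z\in\mathcal X$ and $n\ge1$, a random data set $S_n=\{(X_i,\xi_i)\}_{i\in[n]}$ is generated by a prescribed random design whose law depends only on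 $(z,n)$: $X_1,\dots,X_n$ are i.i.d. from either a fixed density whose support contains $\mathcal X$ (static design) or the density $h_n^{-d}\widetilde g((\cdot-z)/h_n)$ with $\widetilde g$ an even probability density and $h_n>0$ (adaptive design), and given $X_i$, $\xi_i$ is drawn independently from $\mathbb P_\xi(X_i)$. From $S_n$ and $z$ one computes (measurably) an estimate $\widehat\nabla c_n(z)\in\mathbb R^{\ell\times d}$ of $\nabla c(z)$. Define $e_1(n):=\sup_{z\in\mathcal X}\sqrt{\mathbb E[\|\widehat\nabla c_n(z)-\nabla c(z)\|^2]}$. (B) There is a scalar $\widehat\ell_c$ with $\|\widehat\nabla c_n(z)\|\le\widehat\ell_c$ almost surely for all $z\in\mathcal X$, $n\ge1$. L-SPL algorithm. Given $z^0\in\mathcal X$, $T$, positive integers $m_t,n_t$ and proximal parameters $\alpha_t$, for $t=0,\dots,T$: conditionally on the past samples, draw $W^t_{m_t}=\{\eta^t_i\}_{i\in[m_t]}$ i.i.d. from $\mathbb P_\xi(z^t)$ and, independently, a data set $S^t_{n_t}=\{(X^t_i,\xi^t_i)\}_{i\in[n_t]}$ from the prescribed random design with $z=z^t$, $n=n_t$ (that is, $X^t_1,\dots,X^t_{n_t}$ are i.i.d. from the fixed density in the static case, or from the density $h_{n_t}^{-d}\widetilde g((\cdot-z^t)/h_{n_t})$ in the adaptive case, and given $X^t_i$, $\xi^t_i$ is drawn independently from $\mathbb P_\xi(X^t_i)$); form the estimate $\widehat\nabla c^t_{n_t}(z^t)$ from $S^t_{n_t}$; set $$\widehat F^{n_t,m_t}(x,W^t_{m_t};z^t):=\frac1{m_t}\sum_{i\in[m_t]}\varphi\big(x,\eta^t_i+\widehat\nabla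 c^t_{n_t}(z^t)(x-z^t)\big),$$ $$z^{t+1}:=\operatorname*{argmin}_{z\in\mathcal X}\Big\{\widehat F^{n_t,m_t}(z,W^t_{m_t};z^t)+\frac{\alpha_t}2\|z-z^t\|^2\Big\}.$$ *)

theory Defs
  imports "HOL-Probability.Probability"
begin

definition weakly_convex_on ::
  "'a::real_normed_vector set \<Rightarrow> real \<Rightarrow> ('a \<Rightarrow> real) \<Rightarrow> bool" where
  "weakly_convex_on S lam g \<longleftrightarrow> convex_on S (\<lambda>x. g x + lam / 2 * (norm x)\<^sup>2)"

(* The library norm on matrices is the Frobenius norm; this is the induced operator norm. *)
definition mat_norm :: "real^'d^'l \<Rightarrow> real" where
  "mat_norm A = onorm (\<lambda>v. A *v v)"

definition xi_law ::
  "(real^'d \<Rightarrow> real^'l) \<Rightarrow> (real^'l) measure \<Rightarrow> real^'d \<Rightarrow> (real^'l) measure" where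
  "xi_law c nu x = distr nu borel (\<lambda>e. c x + e)"

definition objective ::
  "((real^'d) \<times> (real^'l) \<Rightarrow> real) \<Rightarrow> (real^'d \<Rightarrow> real^'l) \<Rightarrow> (real^'l) measure \<Rightarrow> real^'d \<Rightarrow> real" where
  "objective phi c nu x = (\<integral>e. phi (x, c x + e) \<partial>nu)"

definition moreau ::
  "'a::real_normed_vector set \<Rightarrow> ('a \<Rightarrow> real) \<Rightarrow> real \<Rightarrow> 'a \<Rightarrow> real" where
  "moreau X f rho x = (INF y\<in>X. f y + rho / 2 * (norm (y - x))\<^sup>2)"

definition prox ::
  "'a::real_normed_vector set \<Rightarrow> ('a \<Rightarrow> real) \<Rightarrow> real \<Rightarrow> 'a \<Rightarrow> 'a" where
  "prox X f rho x = arg_min_on (\<lambda>y. f y + rho / 2 * (norm (y - x))\<^sup>2) X"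

definition probability_density :: "(real^'d \<Rightarrow> real) \<Rightarrow> bool" where
  "probability_density g \<longleftrightarrow>
     g \<in> borel_measurable borel \<and> (\<forall>x. 0 \<le> g x) \<and> prob_space (density lborel (\<lambda>x. ennreal (g x)))"

(* Q n z is the common law of the design points X_1, ..., X_n used at the point z. *)
definition static_design ::
  "(real^'d) set \<Rightarrow> (nat \<Rightarrow> real^'d \<Rightarrow> (real^'d) measure) \<Rightarrow> bool" where
  "static_design X Q \<longleftrightarrow>
     (\<exists>g. probability_density g \<and> X \<subseteq> closure {x. g x \<noteq> 0} \<and>
          (\<forall>n\<ge>1. \<forall>z\<in>X. Q n z = density lborel (\<lambda>x. ennreal (g x))))"

definition adaptive_design ::
  "(real^'d) set \<Rightarrow> (nat \<Rightarrow> real^'d \<Rightarrow> (real^'d) measure) \<Rightarrow> bool" where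
  "adaptive_design X Q \<longleftrightarrow>
     (\<exists>g h. probability_density g \<and> (\<forall>x. g (- x) = g x) \<and> (\<forall>n\<ge>1. 0 < h n) \<and>
          (\<forall>n\<ge>1. \<forall>z\<in>X. Q n z =
             density lborel (\<lambda>x. ennreal (g ((x - z) /\<^sub>R h n) / h n ^ CARD('d)))))"

(* The pairs (X_i, xi_i) are i.i.d.: X_i has law Q n z, and xi_i has law xi_law c nu X_i given X_i.
   The design may put mass outside the set on which c is regular; there c is only required to be
   Borel measurable, and its values are arbitrary. *)
definition data_law ::
  "(real^'d \<Rightarrow> real^'l) \<Rightarrow> (real^'l) measure \<Rightarrow> (nat \<Rightarrow> real^'d \<Rightarrow> (real^'d) measure) \<Rightarrow>
   nat \<Rightarrow> real^'d \<Rightarrow> (nat \<Rightarrow> (real^'d) \<times> (real^'l)) measure" where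
  "data_law c nu Q n z =
     PiM {..<n} (\<lambda>_. Q n z \<bind> (\<lambda>x. distr (xi_law c nu x) borel (\<lambda>xi. (x, xi))))"

definition batch_law ::
  "(real^'d \<Rightarrow> real^'l) \<Rightarrow> (real^'l) measure \<Rightarrow> nat \<Rightarrow> real^'d \<Rightarrow> (nat \<Rightarrow> real^'l) measure" where
  "batch_law c nu m z = PiM {..<m} (\<lambda>_. xi_law c nu z)"

definition measurable_estimator ::
  "(real^'d) set \<Rightarrow>
   (nat \<Rightarrow> real^'d \<Rightarrow> (nat \<Rightarrow> (real^'d) \<times> (real^'l)) \<Rightarrow> real^'d^'l) \<Rightarrow> bool" where
  "measurable_estimator X est \<longleftrightarrow>
     (\<forall>n\<ge>1. (\<lambda>(z, D). est n z D)
        \<in> restrict_space borel X \<Otimes>\<^sub>M PiM {..<n} (\<lambda>_. borel) \<rightarrow>\<^sub>M borel)"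

definition e1 ::
  "(real^'d) set \<Rightarrow> (real^'d \<Rightarrow> real^'l) \<Rightarrow> (real^'l) measure \<Rightarrow>
   (nat \<Rightarrow> real^'d \<Rightarrow> (real^'d) measure) \<Rightarrow>
   (nat \<Rightarrow> real^'d \<Rightarrow> (nat \<Rightarrow> (real^'d) \<times> (real^'l)) \<Rightarrow> real^'d^'l) \<Rightarrow> nat \<Rightarrow> real" where
  "e1 X c nu Q est n =
     (SUP z\<in>X. sqrt (\<integral>D. (mat_norm (est n z D - jacobian c (at z)))\<^sup>2 \<partial>data_law c nu Q n z))"

definition empirical_model ::
  "((real^'d) \<times> (real^'l) \<Rightarrow> real) \<Rightarrow> nat \<Rightarrow> (nat \<Rightarrow> real^'l) \<Rightarrow> real^'d^'l \<Rightarrow>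
   real^'d \<Rightarrow> real^'d \<Rightarrow> real" where
  "empirical_model phi m w A z x =
     1 / real m * (\<Sum>i<m. phi (x, w i + A *v (x - z)))"

definition past_samples ::
  "'a measure \<Rightarrow> (nat \<Rightarrow> nat) \<Rightarrow> (nat \<Rightarrow> nat) \<Rightarrow> (nat \<Rightarrow> nat \<Rightarrow> 'a \<Rightarrow> real^'l) \<Rightarrow>
   (nat \<Rightarrow> nat \<Rightarrow> 'a \<Rightarrow> (real^'d) \<times> (real^'l)) \<Rightarrow> nat \<Rightarrow> 'a measure" where
  "past_samples M m n eta S t = sigma (space M)
     (\<Union>s<t. (\<Union>i<m s. {eta s i -` A \<inter> space M | A. A \<in> sets borel}) \<union>
             (\<Union>i<n s. {S s i -` A \<inter> space M | A. A \<in> sets borel}))"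

(* The fourth conjunct: the regular conditional law of the pair (batch, data set) given the past
   samples is the product of the two sampling laws at the current iterate. The fifth: the next
   iterate minimises the proximal subproblem; almost surely, because the bound on the estimate,
   which makes the subproblem strongly convex, is itself only almost sure. *)
definition lspl_run ::
  "'a measure \<Rightarrow> (real^'d) set \<Rightarrow> ((real^'d) \<times> (real^'l) \<Rightarrow> real) \<Rightarrow> (real^'d \<Rightarrow> real^'l) \<Rightarrow>
   (real^'l) measure \<Rightarrow> (nat \<Rightarrow> real^'d \<Rightarrow> (real^'d) measure) \<Rightarrow>
   (nat \<Rightarrow> real^'d \<Rightarrow> (nat \<Rightarrow> (real^'d) \<times> (real^'l)) \<Rightarrow> real^'d^'l) \<Rightarrow>
   (nat \<Rightarrow> nat) \<Rightarrow> (nat \<Rightarrow> nat) \<Rightarrow> (nat \<Rightarrow> real) \<Rightarrow> nat \<Rightarrow> real^'d \<Rightarrow>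
   (nat \<Rightarrow> nat \<Rightarrow> 'a \<Rightarrow> real^'l) \<Rightarrow> (nat \<Rightarrow> nat \<Rightarrow> 'a \<Rightarrow> (real^'d) \<times> (real^'l)) \<Rightarrow>
   (nat \<Rightarrow> 'a \<Rightarrow> real^'d) \<Rightarrow> bool" where
  "lspl_run M X phi c nu Q est m n alpha T z0 eta S z \<longleftrightarrow>
     (\<forall>t\<le>T. (\<forall>i<m t. eta t i \<in> M \<rightarrow>\<^sub>M borel) \<and> (\<forall>i<n t. S t i \<in> M \<rightarrow>\<^sub>M borel)) \<and>
     (\<forall>\<omega>\<in>space M. z 0 \<omega> = z0) \<and>
     (\<forall>t\<le>Suc T. z t \<in> past_samples M m n eta S t \<rightarrow>\<^sub>M restrict_space borel X) \<and>
     (\<forall>t\<le>T. \<forall>A \<in> sets (PiM {..<m t} (\<lambda>_. borel) \<Otimes>\<^sub>M PiM {..<n t} (\<lambda>_. borel)).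
        AE \<omega> in M.
          real_cond_exp M (past_samples M m n eta S t)
            (\<lambda>\<omega>'. indicator A (\<lambda>i\<in>{..<m t}. eta t i \<omega>', \<lambda>i\<in>{..<n t}. S t i \<omega>')) \<omega>
          = measure (batch_law c nu (m t) (z t \<omega>) \<Otimes>\<^sub>M data_law c nu Q (n t) (z t \<omega>)) A) \<and>
     (\<forall>t\<le>T. AE \<omega> in M.
        is_arg_min
          (\<lambda>x. empirical_model phi (m t) (\<lambda>i. eta t i \<omega>)
                  (est (n t) (z t \<omega>) (\<lambda>i\<in>{..<n t}. S t i \<omega>)) (z t \<omega>) x
                + alpha t / 2 * (norm (x - z t \<omega>))\<^sup>2)
          (\<lambda>x. x \<in> X) (z (Suc t) \<omega>))"

end

theory Submission
  imports Defs
begin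

text \<open>
  Write \<^term>\<open>p\<close> for the next iterate from \<^term>\<open>a\<close>. Adding the quadratic growth inequalities of
  the two strongly convex problems solved by \<^term>\<open>p\<close> and by the proximal point of \<^term>\<open>a\<close> bounds
  their distance by the error of the sampled model at these two points. That error splits
  into a sampling part, controlled by the stability of regularised empirical minimisers under the
  replacement of one sample, and a linearisation part, controlled by the Taylor remainder of the
  map \<^term>\<open>c\<close> and the Jacobian estimation error. The Moreau envelope therefore decreases in
  expectation up to the noise, and summing over the iterations and averaging over the
  random index gives the bound on the mean squared residual; Jensen's inequality concludes.

  All expectations along the run are nonnegative extended integrals of the envelope minus
  its minimum, so no integrability of the iterates is needed before the final step.
\<close>

section \<open>Weak convexity and proximal points\<close>

text \<open>The main obstacle is that the next iterate \<open>p\<close> is chosen from the batch, so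
  the sampled model is biased at \<open>p\<close>. At the proximal point of \<open>a\<close>, which
  is fixed before sampling, its error has mean zero; stability is therefore invoked at one of the
  two points only. The two growth inequalities give the squared distance between the points the
  coefficient \<open>(al + rho - tau) / 2\<close>. The factor \<open>rho / (al + rho - tau)\<close>
  turns this into the \<open>rho / 2\<close> of the envelope at \<open>p\<close>, and the law of the
  random index is proportional to the weights that this factor leaves on the residuals. The linear
  error at \<open>p\<close> is absorbed because \<open>al > rho + lphi * Lc\<close>; the one at the
  proximal point consumes half of the available decrease. Clearing the resulting denominator 4
  produces the constants 4, 8, 4 and 2 of the bound. A second obstacle is that the estimate is
  bounded only almost surely and that conditional laws are given set by set. The run is therefore
  compared with a measurable step map defined everywhere, and expectations become iterated integrals
  against kernels.\<close>

lemma norm_convex_combination: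
  fixes x y :: "'a::real_inner"
  shows "(norm ((1 - s) *\<^sub>R x + s *\<^sub>R y))\<^sup>2
    = (1 - s) * (norm x)\<^sup>2 + s * (norm y)\<^sup>2 - s * (1 - s) * (norm (x - y))\<^sup>2"
  unfolding power2_norm_eq_inner
  by (simp add: inner_add_left inner_add_right inner_diff_left inner_diff_right inner_commute)
    (simp add: algebra_simps)

text \<open>The squared norms cancel by the identity above and leave a defect in
  \<open>norm (x - y)\<close> alone. In this form a modulus can be read off, summed over samples and
  integrated over the noise.\<close>

lemma weakly_convex_onD:
  fixes g :: "'a::real_inner \<Rightarrow> real"
  assumes "weakly_convex_on S k g" "x \<in> S" "y \<in> S" "0 \<le> s" "s \<le> 1"
  shows "g ((1 - s) *\<^sub>R x + s *\<^sub>R y)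
    \<le> (1 - s) * g x + s * g y + k / 2 * (s * (1 - s) * (norm (x - y))\<^sup>2)"
proof -
  have "g ((1 - s) *\<^sub>R x + s *\<^sub>R y) + k / 2 * (norm ((1 - s) *\<^sub>R x + s *\<^sub>R y))\<^sup>2
    \<le> (1 - s) * (g x + k / 2 * (norm x)\<^sup>2) + s * (g y + k / 2 * (norm y)\<^sup>2)"
    using assms convex_onD[of S "\<lambda>x. g x + k / 2 * (norm x)\<^sup>2" s x y]
    by (simp add: weakly_convex_on_def)
  then show ?thesis
    unfolding norm_convex_combination
    by (simp add: algebra_simps add_divide_distrib diff_divide_distrib)
qed

lemma weakly_convex_onI:
  fixes g :: "'a::real_inner \<Rightarrow> real"
  assumes "convex S"
    and "\<And>x y s. x \<in> S \<Longrightarrow> y \<in> S \<Longrightarrow> 0 < s \<Longrightarrow> s < 1 \<Longrightarrow>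
      g ((1 - s) *\<^sub>R x + s *\<^sub>R y)
        \<le> (1 - s) * g x + s * g y + k / 2 * (s * (1 - s) * (norm (x - y))\<^sup>2)"
  shows "weakly_convex_on S k g"
  unfolding weakly_convex_on_def
proof (rule convex_onI)
  fix t :: real and x y assume "0 < t" "t < 1" "x \<in> S" "y \<in> S"
  then show "g ((1 - t) *\<^sub>R x + t *\<^sub>R y) + k / 2 * (norm ((1 - t) *\<^sub>R x + t *\<^sub>R y))\<^sup>2
    \<le> (1 - t) * (g x + k / 2 * (norm x)\<^sup>2) + t * (g y + k / 2 * (norm y)\<^sup>2)"
    using assms(2)[of x y t] unfolding norm_convex_combination
    by (simp add: algebra_simps add_divide_distrib diff_divide_distrib)
qed (use assms in auto)

text \<open>Compare \<open>p\<close> with a point of the segment towards \<open>y\<close>, divide by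
  the parameter \<open>s\<close> and let \<open>s\<close> tend to 0. Every comparison of minimisers
  below rests on this inequality.\<close>

lemma is_arg_min_growth:
  fixes g :: "'a::real_inner \<Rightarrow> real"
  assumes wc: "weakly_convex_on X k g"
    and p: "is_arg_min (\<lambda>x. g x + al / 2 * (norm (x - a))\<^sup>2) (\<lambda>x. x \<in> X) p"
    and y: "y \<in> X"
  shows "g p + al / 2 * (norm (p - a))\<^sup>2 + (al - k) / 2 * (norm (y - p))\<^sup>2
    \<le> g y + al / 2 * (norm (y - a))\<^sup>2"
proof -
  have X: "convex X" and pX: "p \<in> X"
    using wc p by (auto simp: weakly_convex_on_def convex_on_def is_arg_min_def)
  let ?h = "\<lambda>x. g x + al / 2 * (norm (x - a))\<^sup>2"
  have *: "?h p + (al - k) / 2 * (1 - s) * (norm (y - p))\<^sup>2 \<le> ?h y" if s: "0 < s" "s < 1" for s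
  proof -
    let ?q = "(1 - s) *\<^sub>R p + s *\<^sub>R y"
    have "?q \<in> X" using X pX y s by (auto simp: convex_alt)
    then have "?h p \<le> ?h ?q" using p unfolding is_arg_min_def by force
    also have "?q - a = (1 - s) *\<^sub>R (p - a) + s *\<^sub>R (y - a)"
      by (simp add: algebra_simps)
    then have "?h ?q = g ?q + al / 2 * ((1 - s) * (norm (p - a))\<^sup>2 + s * (norm (y - a))\<^sup>2
        - s * (1 - s) * (norm (y - p))\<^sup>2)"
      using norm_convex_combination[of s "p - a" "y - a"] by (simp add: norm_minus_commute)
    also have "g ?q \<le> (1 - s) * g p + s * g y + k / 2 * (s * (1 - s) * (norm (y - p))\<^sup>2)"
      using weakly_convex_onD[OF wc pX y, of s] s by (simp add: norm_minus_commute)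
    finally have "s * (?h p + (al - k) / 2 * (1 - s) * (norm (y - p))\<^sup>2) \<le> s * ?h y"
      by (simp add: algebra_simps diff_divide_distrib add_divide_distrib)
    then show ?thesis using s by simp
  qed
  \<comment> \<open>For fixed \<open>s\<close> the growth constant carries the factor
    \<open>1 - s\<close>; the one-sided limit at 0 removes it.\<close>
  have "((\<lambda>s. ?h p + (al - k) / 2 * (1 - s) * (norm (y - p))\<^sup>2)
      \<longlongrightarrow> ?h p + (al - k) / 2 * (1 - 0) * (norm (y - p))\<^sup>2) (at_right 0)"
    by (intro tendsto_intros)
  moreover have "eventually (\<lambda>s. ?h p + (al - k) / 2 * (1 - s) * (norm (y - p))\<^sup>2 \<le> ?h y) (at_right 0)"
    using eventually_at_right_real[OF zero_less_one] by eventually_elim (use * in auto)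
  ultimately show ?thesis
    using tendsto_upperbound[of _ _ "at_right (0::real)" "?h y"] by force
qed

lemma is_arg_min_unique:
  fixes g :: "'a::real_inner \<Rightarrow> real"
  assumes "weakly_convex_on X k g" "k < al"
    and p: "is_arg_min (\<lambda>x. g x + al / 2 * (norm (x - a))\<^sup>2) (\<lambda>x. x \<in> X) p"
    and q: "is_arg_min (\<lambda>x. g x + al / 2 * (norm (x - a))\<^sup>2) (\<lambda>x. x \<in> X) q"
  shows "p = q"
proof -
  have "q \<in> X" using q by (simp add: is_arg_min_def)
  from is_arg_min_growth[OF assms(1) p this]
  have "(al - k) / 2 * (norm (q - p))\<^sup>2 \<le> 0"
    using p q by (force simp: is_arg_min_def)
  then show ?thesis using assms(2) by (auto simp: mult_le_0_iff)
qed

text \<open>Testing minimality against \<open>a\<close> itself bounds a quadratic by a linear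
  function of the displacement. The radius \<open>2 * L / al\<close> reappears as the compact search
  region for existence and in the dominating function of the stability argument.\<close>

lemma is_arg_min_displacement:
  fixes g :: "'a::real_normed_vector \<Rightarrow> real"
  assumes lip: "L-lipschitz_on X g" and al: "0 < al" and a: "a \<in> X"
    and p: "is_arg_min (\<lambda>x. g x + al / 2 * (norm (x - a))\<^sup>2) (\<lambda>x. x \<in> X) p"
  shows "norm (p - a) \<le> 2 * L / al"
proof (cases "p = a")
  case False
  have pX: "p \<in> X" using p by (simp add: is_arg_min_def)
  have "g p + al / 2 * (norm (p - a))\<^sup>2 \<le> g a"
    using p a by (force simp: is_arg_min_def)
  moreover have "\<bar>g p - g a\<bar> \<le> L * norm (p - a)"
    using lipschitz_onD[OF lip pX a] by (simp add: dist_norm)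
  ultimately have "(al / 2 * norm (p - a)) * norm (p - a) \<le> L * norm (p - a)"
    by (auto simp: power2_eq_square algebra_simps)
  then have "al / 2 * norm (p - a) \<le> L" using False by simp
  then show ?thesis using al by (simp add: field_simps)
qed (use lipschitz_on_nonneg[OF lip] al in simp)

text \<open>\<open>prox\<close> is defined by choice, so it meets its specification once some
  minimiser exists. Outside the ball of radius \<open>2 * L / al\<close> the quadratic term
  outweighs the variation of \<open>g\<close>, which reduces existence to a compact set containing
  \<open>a\<close>.\<close>

lemma prox_is_arg_min:
  fixes g :: "'a::euclidean_space \<Rightarrow> real"
  assumes X: "closed X" and lip: "L-lipschitz_on X g" and al: "0 < al" and a: "a \<in> X"
  shows "is_arg_min (\<lambda>x. g x + al / 2 * (norm (x - a))\<^sup>2) (\<lambda>x. x \<in> X) (prox X g al a)"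
proof -
  let ?h = "\<lambda>x. g x + al / 2 * (norm (x - a))\<^sup>2"
  let ?K = "X \<inter> cball a (2 * L / al)"
  have L: "0 \<le> L" using lip by (rule lipschitz_on_nonneg)
  have aK: "a \<in> ?K" using a L al by auto
  have "compact ?K" using X by (simp add: closed_Int_compact)
  moreover have "continuous_on ?K ?h"
    by (intro continuous_intros continuous_on_subset[OF lipschitz_on_continuous_on[OF lip]]) auto
  ultimately obtain p where p: "p \<in> ?K" "\<And>y. y \<in> ?K \<Longrightarrow> ?h p \<le> ?h y"
    using continuous_attains_inf[of ?K ?h] aK by blast
  have "?h p \<le> ?h y" if y: "y \<in> X" for y
  proof (cases "y \<in> ?K")
    case False
    then have "2 * L / al < norm (y - a)" using y by (auto simp: dist_norm norm_minus_commute)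
    then have "L * norm (y - a) \<le> al / 2 * norm (y - a) * norm (y - a)"
      using al by (intro mult_right_mono) (auto simp: field_simps)
    moreover have "\<bar>g y - g a\<bar> \<le> L * norm (y - a)"
      using lipschitz_onD[OF lip y a] by (simp add: dist_norm)
    ultimately have "?h a \<le> ?h y" by (simp add: power2_eq_square algebra_simps abs_le_iff)
    then show ?thesis using p(2)[OF aK] by simp
  qed (use p in auto)
  then have "is_arg_min ?h (\<lambda>x. x \<in> X) p"
    using p(1) by (auto simp: is_arg_min_def not_less)
  then show ?thesis
    unfolding prox_def arg_min_on_def arg_min_def by (rule someI)
qed

text \<open>Each minimiser is tested against the other by quadratic growth. On adding, the proximal
  terms cancel and what remains is the increment of \<open>g1 - g2\<close> between the two points,
  which is linear in their distance.\<close>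

lemma prox_stable:
  fixes g1 g2 :: "'a::euclidean_space \<Rightarrow> real"
  assumes "closed X" "0 < al" "k < al" "a \<in> X"
    and "L-lipschitz_on X g1" "L-lipschitz_on X g2"
    and "weakly_convex_on X k g1" "weakly_convex_on X k g2"
    and "D-lipschitz_on X (\<lambda>x. g1 x - g2 x)"
  shows "norm (prox X g1 al a - prox X g2 al a) \<le> D / (al - k)"
proof -
  let ?p = "prox X g1 al a" and ?q = "prox X g2 al a"
  note p = prox_is_arg_min[OF assms(1,5,2,4)] and q = prox_is_arg_min[OF assms(1,6,2,4)]
  have pq: "?p \<in> X" "?q \<in> X" using p q by (auto simp: is_arg_min_def)
  have "(al - k) * (norm (?p - ?q))\<^sup>2 \<le> (g1 ?q - g2 ?q) - (g1 ?p - g2 ?p)"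
    using is_arg_min_growth[OF assms(7) p pq(2)] is_arg_min_growth[OF assms(8) q pq(1)]
    by (simp add: norm_minus_commute algebra_simps diff_divide_distrib)
  also have "\<dots> \<le> D * norm (?p - ?q)"
    using lipschitz_onD[OF assms(9) pq(2,1)] by (simp add: dist_norm norm_minus_commute abs_le_iff)
  finally have "((al - k) * norm (?p - ?q)) * norm (?p - ?q) \<le> D * norm (?p - ?q)"
    by (simp add: power2_eq_square)
  note D = this
  show ?thesis
  proof (cases "?p = ?q")
    case True
    then show ?thesis using assms(3) lipschitz_on_nonneg[OF assms(9)] by simp
  next
    case False
    then have "(al - k) * norm (?p - ?q) \<le> D"
      using D by (simp add: mult_le_cancel_right)
    then show ?thesis using assms(3) by (simp add: field_simps)
  qed
qed

lemma moreau_eq_prox: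
  fixes g :: "'a::real_normed_vector \<Rightarrow> real"
  assumes "is_arg_min (\<lambda>x. g x + al / 2 * (norm (x - a))\<^sup>2) (\<lambda>x. x \<in> X) p"
  shows "moreau X g al a = g p + al / 2 * (norm (p - a))\<^sup>2"
  unfolding moreau_def using assms
  by (intro cInf_eq_minimum) (auto simp: is_arg_min_def not_less)

text \<open>The minimiser is the pointwise limit of the first almost-minimisers in a countable dense
  subset, to which it is close by quadratic growth.\<close>

lemma borel_measurable_argmin:
  fixes h :: "'b \<Rightarrow> 'a::euclidean_space \<Rightarrow> real"
  assumes meas: "\<And>x. x \<in> X \<Longrightarrow> (\<lambda>w. h w x) \<in> borel_measurable N"
    and cont: "\<And>w. w \<in> space N \<Longrightarrow> continuous_on X (h w)"
    and p: "\<And>w. w \<in> space N \<Longrightarrow> p w \<in> X"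
    and growth: "\<And>w x. w \<in> space N \<Longrightarrow> x \<in> X \<Longrightarrow> h w (p w) + mu * (dist x (p w))\<^sup>2 \<le> h w x"
    and mu: "0 < mu"
  shows "p \<in> borel_measurable N"
proof (cases "space N = {}")
  case True
  then show ?thesis by (intro measurableI) auto
next
  case False
  obtain D where D: "countable D" "D \<subseteq> X" "X \<subseteq> closure D"
    using separable[of X] by blast
  have "D \<noteq> {}" using False p D(3) by force
  define d where "d = from_nat_into D"
  have range_d: "range d = D" using D(1) \<open>D \<noteq> {}\<close> by (simp add: d_def range_from_nat_into)
  then have dX: "d j \<in> X" for j using D(2) by auto
  have [measurable]: "(\<lambda>w. h w (d j)) \<in> borel_measurable N" for j by (rule meas[OF dX])
  \<comment> \<open>\<open>P\<close> refers to values at the dense points only and not to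
    \<open>p\<close>, so it is a countable conjunction of measurable conditions.\<close>
  define P where "P k w j \<longleftrightarrow> (\<forall>i. h w (d j) \<le> h w (d i) + 1 / real (Suc k))" for k w j
  define q where "q k w = d (LEAST j. P k w j)" for k w
  have P_meas: "Measurable.pred N (\<lambda>w. P k w j)" for k j
    unfolding P_def by measurable
  have q_meas: "q k \<in> borel_measurable N" for k
    unfolding q_def by (rule measurable_compose[OF measurable_Least[OF P_meas]]) auto
  have approx: "\<exists>j. h w (d j) < h w (p w) + e" if w: "w \<in> space N" and e: "0 < e" for w e
  proof -
    obtain r where r: "0 < r"
      "\<And>x. x \<in> X \<Longrightarrow> dist x (p w) < r \<Longrightarrow> dist (h w x) (h w (p w)) < e"
      using cont[OF w] p[OF w] e unfolding continuous_on_iff by blast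
    have "p w \<in> closure D" using p[OF w] D(3) by auto
    then obtain x where x: "x \<in> D" "dist x (p w) < r"
      using r(1) unfolding closure_approachable by blast
    then obtain j where "x = d j" using range_d by blast
    then have "dist (h w (d j)) (h w (p w)) < e"
      using r(2)[of x] x dX by auto
    then show ?thesis by (auto simp: dist_real_def abs_less_iff algebra_simps intro!: exI[of _ j])
  qed
  have le: "h w (p w) \<le> h w x" if "w \<in> space N" "x \<in> X" for w x
  proof -
    have "0 \<le> mu * (dist x (p w))\<^sup>2" using mu by simp
    then show ?thesis using growth[OF that] by linarith
  qed
  have q_near: "(dist (q k w) (p w))\<^sup>2 \<le> 1 / mu * (1 / real (Suc k))" if w: "w \<in> space N" for k w
  proof -
    obtain j where j: "h w (d j) < h w (p w) + 1 / real (Suc k)"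
      using approx[OF w, of "1 / real (Suc k)"] by auto
    have "P k w j" unfolding P_def using j le[OF w dX] by (meson add_right_mono less_imp_le order_trans)
    then have "P k w (LEAST j. P k w j)" by (rule LeastI)
    then have "h w (q k w) \<le> h w (d i) + 1 / real (Suc k)" for i
      unfolding P_def q_def by blast
    \<comment> \<open>By continuity the values at dense points come arbitrarily close to the
      minimum, so almost-minimality over the dense set is almost-minimality over
      \<open>X\<close>.\<close>
    then have "h w (q k w) \<le> h w (p w) + 1 / real (Suc k) + e" if "0 < e" for e
      using approx[OF w that] by (smt (verit))
    then have "h w (q k w) \<le> h w (p w) + 1 / real (Suc k)"
      by (rule field_le_epsilon)
    then have "mu * (dist (q k w) (p w))\<^sup>2 \<le> 1 / real (Suc k)"
      using growth[OF w dX, of "LEAST j. P k w j"] unfolding q_def[symmetric] by linarith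
    from mult_left_mono[OF this, of "1 / mu"] mu show ?thesis by (simp del: of_nat_Suc)
  qed
  have "(\<lambda>k. q k w) \<longlonglongrightarrow> p w" if w: "w \<in> space N" for w
  proof -
    have "(\<lambda>k. 1 / mu * (1 / real (Suc k))) \<longlonglongrightarrow> 1 / mu * 0"
      by (intro tendsto_mult tendsto_const LIMSEQ_Suc[OF lim_inverse_n'])
    then have null: "(\<lambda>k. 1 / mu * (1 / real (Suc k))) \<longlonglongrightarrow> 0" by simp
    have "(\<lambda>k. (dist (q k w) (p w))\<^sup>2) \<longlonglongrightarrow> 0"
      by (rule Lim_null_comparison[OF _ null]) (use q_near[OF w] in simp)
    then have "(\<lambda>k. sqrt ((dist (q k w) (p w))\<^sup>2)) \<longlonglongrightarrow> sqrt 0" by (rule tendsto_real_sqrt)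
    then show ?thesis using tendsto_dist_iff[of "\<lambda>k. q k w" "p w"] by simp
  qed
  then show ?thesis by (rule borel_measurable_LIMSEQ_metric[OF q_meas])
qed

section \<open>Operator norm and Jacobian\<close>

lemma mat_norm_nonneg: "0 \<le> mat_norm A"
  unfolding mat_norm_def by (rule onorm_pos_le) (simp add: linear_linear)

lemma mat_norm_mult_vec: "norm (A *v v) \<le> mat_norm A * norm v"
  unfolding mat_norm_def by (rule onorm) (simp add: linear_linear)

lemma mat_norm_le: "(\<And>v. norm (A *v v) \<le> b * norm v) \<Longrightarrow> mat_norm A \<le> b"
  unfolding mat_norm_def by (rule onorm_le)

lemma mat_norm_zero [simp]: "mat_norm (0 :: real^'d^'l) = 0"
proof -
  have "(*v) (0 :: real^'d^'l) = (\<lambda>v. 0)" by auto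
  then show ?thesis unfolding mat_norm_def by (simp add: onorm_zero)
qed

lemma mat_norm_triangle: "mat_norm (A + B) \<le> mat_norm A + mat_norm B"
  unfolding mat_norm_def matrix_vector_mult_add_rdistrib
  by (rule onorm_triangle) (simp_all add: linear_linear)

lemma mat_norm_minus: "mat_norm (- A) = mat_norm A"
proof -
  have "(*v) (- A) = (\<lambda>v. - (A *v v))"
    using matrix_vector_mult_diff_rdistrib[of 0 A] by (simp only: fun_eq_iff diff_0 matrix_vector_mult_0 simp_thms)
  then show ?thesis unfolding mat_norm_def by (simp add: onorm_neg)
qed

lemma mat_norm_diff: "mat_norm (A - B) \<le> mat_norm A + mat_norm B"
  using mat_norm_triangle[of A "- B"] by (simp add: mat_norm_minus)

text \<open>The topology on matrices comes from the Frobenius norm. The reverse triangle inequality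
  and a bound through the entries make the operator norm Lipschitz for it.\<close>

lemma borel_measurable_mat_norm [measurable]: "mat_norm \<in> borel_measurable borel"
proof -
  have "\<bar>mat_norm A - mat_norm B\<bar> \<le> mat_norm (A - B)" for A B :: "real^'d^'l"
    using mat_norm_triangle[of "A - B" B] mat_norm_triangle[of "B - A" A] mat_norm_minus[of "A - B"]
    by (simp add: abs_le_iff)
  moreover have "mat_norm A \<le> real CARD('l) * real CARD('d) * norm A" for A :: "real^'d^'l"
    unfolding mat_norm_def
    by (intro onorm_le_matrix_component order_trans[OF component_le_norm_cart Finite_Cartesian_Product.norm_nth_le])
  ultimately have "\<bar>mat_norm A - mat_norm B\<bar> \<le> real CARD('l) * real CARD('d) * norm (A - B)"
    for A B :: "real^'d^'l"
    by (meson order_trans)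
  then have "(real CARD('l) * real CARD('d))-lipschitz_on UNIV (mat_norm :: real^'d^'l \<Rightarrow> real)"
    by (intro lipschitz_onI) (auto simp: dist_norm)
  then show ?thesis
    by (intro borel_measurable_continuous_onI lipschitz_on_continuous_on)
qed

text \<open>With the linear part subtracted, the curve along the segment has a derivative of norm at
  most \<open>L * (norm (y - x))\<^sup>2 * s\<close>. Comparison with the majorant
  \<open>?phi\<close>, whose derivative is exactly this, gives the factor 1/2 without integrating
  the Jacobian.\<close>

lemma jacobian_taylor:
  fixes c :: "real^'d \<Rightarrow> real^'l"
  assumes U: "open U" "convex U" and diff: "c differentiable_on U"
    and lip: "\<forall>x\<in>U. \<forall>y\<in>U. mat_norm (jacobian c (at x) - jacobian c (at y)) \<le> L * norm (x - y)"
    and x: "x \<in> U" and y: "y \<in> U"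
  shows "norm (c y - c x - jacobian c (at x) *v (y - x)) \<le> L / 2 * (norm (y - x))\<^sup>2"
proof -
  let ?J = "\<lambda>x. jacobian c (at x)"
  let ?g = "\<lambda>s. x + s *\<^sub>R (y - x)"
  let ?f = "\<lambda>s. c (?g s) - s *\<^sub>R (?J x *v (y - x))"
  let ?phi = "\<lambda>s. L / 2 * (norm (y - x))\<^sup>2 * s\<^sup>2"
  have seg: "?g s \<in> U" if "0 \<le> s" "s \<le> 1" for s
  proof -
    have "?g s = (1 - s) *\<^sub>R x + s *\<^sub>R y" by (simp add: algebra_simps)
    then show ?thesis using U(2) x y that by (auto simp: convex_alt)
  qed
  have der: "(c has_derivative (\<lambda>v. ?J w *v v)) (at w)" if "w \<in> U" for w
    using diff that U(1) jacobian_works[of c "at w"]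
    by (simp add: differentiable_on_eq_differentiable_at)
  have df: "(?f has_vector_derivative (?J (?g s) *v (y - x) - ?J x *v (y - x))) (at s)"
    if s: "0 \<le> s" "s \<le> 1" for s
  proof -
    have "(?g has_derivative (\<lambda>h. h *\<^sub>R (y - x))) (at s)"
      by (auto intro!: derivative_eq_intros)
    from diff_chain_at[OF this der[OF seg[OF s]]]
    have "((c \<circ> ?g) has_vector_derivative (?J (?g s) *v (y - x))) (at s)"
      by (simp add: has_vector_derivative_def o_def matrix_vector_mult_scaleR)
    then show ?thesis
      by (auto intro!: derivative_eq_intros simp: o_def)
  qed
  have dphi: "(?phi has_vector_derivative (L * (norm (y - x))\<^sup>2 * s)) (at s)" for s
    by (auto intro!: derivative_eq_intros simp: has_real_derivative_iff_has_vector_derivative[symmetric])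
  have "norm (?f 1 - ?f 0) \<le> ?phi 1 - ?phi 0"
  proof (rule differentiable_bound_general[OF zero_less_one])
    show "continuous_on {0..1} ?f"
      by (intro continuous_at_imp_continuous_on ballI has_vector_derivative_continuous[OF df]) auto
    show "continuous_on {0..1} ?phi" by (intro continuous_intros)
    fix s :: real assume s: "0 < s" "s < 1"
    show "(?f has_vector_derivative (?J (?g s) *v (y - x) - ?J x *v (y - x))) (at s)"
      using df s by simp
    show "(?phi has_vector_derivative (L * (norm (y - x))\<^sup>2 * s)) (at s)" by (rule dphi)
    have "norm (?J (?g s) *v (y - x) - ?J x *v (y - x))
        = norm ((?J (?g s) - ?J x) *v (y - x))"
      by (simp add: matrix_vector_mult_diff_rdistrib)
    also have "\<dots> \<le> mat_norm (?J (?g s) - ?J x) * norm (y - x)"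
      by (rule mat_norm_mult_vec)
    also have "\<dots> \<le> (L * norm (?g s - x)) * norm (y - x)"
      using lip[rule_format, OF seg x] s by (intro mult_right_mono) auto
    also have "\<dots> = L * (norm (y - x))\<^sup>2 * s"
      using s by (simp add: power2_eq_square)
    finally show "norm (?J (?g s) *v (y - x) - ?J x *v (y - x)) \<le> L * (norm (y - x))\<^sup>2 * s" .
  qed
  then show ?thesis by (simp add: algebra_simps)
qed

section \<open>Kernels and disintegration\<close>

text \<open>Boxes form an intersection-stable generator, and on a box the product measure is a
  finite product of functions measurable in \<open>x\<close>. This makes the laws of whole batches
  and data sets kernels in the current iterate.\<close>

lemma measurable_PiM_prob_algebra:
  assumes I: "finite I" and K: "\<And>i. K i \<in> L \<rightarrow>\<^sub>M prob_algebra (N i)"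
  shows "(\<lambda>x. PiM I (\<lambda>i. K i x)) \<in> L \<rightarrow>\<^sub>M prob_algebra (PiM I N)"
proof (rule measurable_prob_algebra_generated[OF sets_PiM Int_stable_prod_algebra])
  show "prod_algebra I N \<subseteq> Pow (\<Pi>\<^sub>E i\<in>I. space (N i))"
    by (rule prod_algebra_sets_into_space)
next
  fix x assume x: "x \<in> space L"
  have Kx: "prob_space (K i x)" "sets (K i x) = sets (N i)" for i
    using measurable_space[OF K x] by (auto simp: space_prob_algebra)
  show "prob_space (PiM I (\<lambda>i. K i x))" by (rule prob_space_PiM) (rule Kx)
  show "sets (PiM I (\<lambda>i. K i x)) = sets (PiM I N)" by (rule sets_PiM_cong) (simp_all add: Kx)
next
  fix A assume "A \<in> prod_algebra I N"
  then obtain E where E: "A = Pi\<^sub>E I E" "E \<in> (\<Pi> i\<in>I. sets (N i))"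
    by (rule prod_algebraE_all)
  have "emeasure (PiM I (\<lambda>i. K i x)) A = (\<Prod>i\<in>I. emeasure (K i x) (E i))" if x: "x \<in> space L" for x
  proof -
    have Kx: "prob_space (K i x)" "sets (K i x) = sets (N i)" for i
      using measurable_space[OF K x] by (auto simp: space_prob_algebra)
    interpret product_sigma_finite "\<lambda>i. K i x"
      using Kx(1) prob_space_imp_sigma_finite by (auto simp: product_sigma_finite_def)
    show ?thesis unfolding E(1) using E(2) Kx(2) by (intro emeasure_PiM[OF I]) auto
  qed
  moreover have "(\<lambda>x. \<Prod>i\<in>I. emeasure (K i x) (E i)) \<in> borel_measurable L"
  proof (rule borel_measurable_prod_ennreal)
    fix i assume "i \<in> I"
    then have "E i \<in> sets (N i)" using E(2) by auto
    then show "(\<lambda>x. emeasure (K i x) (E i)) \<in> borel_measurable L"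
      using measurable_compose[OF measurable_prob_algebraD[OF K] measurable_emeasure_subprob_algebra] by blast
  qed
  ultimately show "(\<lambda>x. emeasure (PiM I (\<lambda>i. K i x)) A) \<in> borel_measurable L"
    by (simp cong: measurable_cong)
qed

lemma nn_integral_kernel:
  assumes M: "prob_space M" and F: "subalgebra M F"
    and Z: "Z \<in> F \<rightarrow>\<^sub>M B" and Y: "Y \<in> M \<rightarrow>\<^sub>M N"
    and K: "K \<in> B \<rightarrow>\<^sub>M prob_algebra N"
    and law: "\<And>A. A \<in> sets N \<Longrightarrow>
      AE \<omega> in M. real_cond_exp M F (\<lambda>\<omega>'. indicator A (Y \<omega>')) \<omega> = measure (K (Z \<omega>)) A"
    and H: "H \<in> borel_measurable (B \<Otimes>\<^sub>M N)"
  shows "(\<integral>\<^sup>+\<omega>. H (Z \<omega>, Y \<omega>) \<partial>M) = (\<integral>\<^sup>+\<omega>. (\<integral>\<^sup>+y. H (Z \<omega>, y) \<partial>K (Z \<omega>)) \<partial>M)"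
proof -
  interpret M: prob_space M by fact
  interpret finite_measure_subalgebra M F by unfold_locales (rule F)
  have ZM: "Z \<in> M \<rightarrow>\<^sub>M B" using measurable_from_subalg[OF F Z] .
  note [measurable] = ZM Y
  \<comment> \<open>\<open>G z\<close> is the law \<open>K z\<close> with the point \<open>z\<close>
    recorded as first coordinate, so that \<open>distr M B Z \<bind> G\<close> is the candidate
    joint law.\<close>
  define G where "G z = distr (K z) (B \<Otimes>\<^sub>M N) (Pair z)" for z
  have G: "G \<in> B \<rightarrow>\<^sub>M prob_algebra (B \<Otimes>\<^sub>M N)"
    unfolding G_def by (rule measurable_distr_prob_space2[OF K]) simp
  have D: "distr M B Z \<in> space (prob_algebra B)"
    by (simp add: space_prob_algebra M.prob_space_distr)
  have KZ: "prob_space (K (Z \<omega>))" "sets (K (Z \<omega>)) = sets N" "Z \<omega> \<in> space B" if "\<omega> \<in> space M" for \<omega>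
    using measurable_space[OF K measurable_space[OF ZM that]] measurable_space[OF ZM that]
    by (auto simp: space_prob_algebra)
  have Pair_meas: "Pair (Z \<omega>) \<in> K (Z \<omega>) \<rightarrow>\<^sub>M B \<Otimes>\<^sub>M N" if "\<omega> \<in> space M" for \<omega>
    using measurable_cong_sets[OF KZ(2)[OF that] refl] measurable_Pair1'[OF KZ(3)[OF that]] by blast
  have "distr M (B \<Otimes>\<^sub>M N) (\<lambda>\<omega>. (Z \<omega>, Y \<omega>)) = distr M B Z \<bind> G" (is "?L = ?R")
  proof (rule measure_eqI_generator_eq[OF Int_stable_pair_measure_generator pair_measure_closed])
    show "sets ?L = sigma_sets (space B \<times> space N) {a \<times> b |a b. a \<in> sets B \<and> b \<in> sets N}"
      by (simp add: sets_pair_measure)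
    show "sets ?R = sigma_sets (space B \<times> space N) {a \<times> b |a b. a \<in> sets B \<and> b \<in> sets N}"
      using sets_bind'[OF D G] by (simp add: sets_pair_measure)
    show "range (\<lambda>i::nat. space B \<times> space N) \<subseteq> {a \<times> b |a b. a \<in> sets B \<and> b \<in> sets N}" by auto
    show "(\<Union>i::nat. space B \<times> space N) = space B \<times> space N" by simp
    show "emeasure ?L (space B \<times> space N) \<noteq> \<infinity>"
      by (subst emeasure_distr) (auto simp: M.emeasure_eq_measure)
    fix X assume "X \<in> {a \<times> b |a b. a \<in> sets B \<and> b \<in> sets N}"
    then obtain a b where X: "X = a \<times> b" and ab[measurable]: "a \<in> sets B" "b \<in> sets N" by auto
    have aF: "(\<lambda>\<omega>. indicator a (Z \<omega>) :: real) \<in> borel_measurable F"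
      using Z by measurable
    have int: "integrable M (\<lambda>\<omega>. indicator a (Z \<omega>) * indicator b (Y \<omega>) :: real)"
      by (rule M.integrable_const_bound[where B=1]) (auto simp: indicator_def)
    note ce = real_cond_exp_intg[OF int aF]
    have "emeasure ?L X = (\<integral>\<^sup>+\<omega>. indicator X (Z \<omega>, Y \<omega>) \<partial>M)"
      unfolding X by (subst nn_integral_indicator[symmetric], simp, subst nn_integral_distr) auto
    also have "\<dots> = (\<integral>\<^sup>+\<omega>. ennreal (indicator a (Z \<omega>) * indicator b (Y \<omega>)) \<partial>M)"
      by (intro nn_integral_cong) (auto simp: X indicator_def)
    also have "\<dots> = ennreal (\<integral>\<omega>. indicator a (Z \<omega>) * indicator b (Y \<omega>) \<partial>M)"
      by (rule nn_integral_eq_integral[OF int]) simp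
    also have "(\<integral>\<omega>. indicator a (Z \<omega>) * indicator b (Y \<omega>) \<partial>M)
        = (\<integral>\<omega>. indicator a (Z \<omega>) * real_cond_exp M F (\<lambda>\<omega>'. indicator b (Y \<omega>')) \<omega> \<partial>M)"
      by (rule ce(2)[symmetric]) simp
    also have "ennreal \<dots>
        = (\<integral>\<^sup>+\<omega>. ennreal (indicator a (Z \<omega>) * real_cond_exp M F (\<lambda>\<omega>'. indicator b (Y \<omega>')) \<omega>) \<partial>M)"
      using law[OF ab(2)]
      by (intro nn_integral_eq_integral[symmetric] ce(1)) auto
    also have "\<dots> = (\<integral>\<^sup>+\<omega>. emeasure (G (Z \<omega>)) X \<partial>M)"
    proof (rule nn_integral_cong_AE, use AE_space law[OF ab(2)] in eventually_elim)
      fix \<omega> assume w: "\<omega> \<in> space M" and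
        rc: "real_cond_exp M F (\<lambda>\<omega>'. indicator b (Y \<omega>')) \<omega> = measure (K (Z \<omega>)) b"
      interpret K: prob_space "K (Z \<omega>)" by (rule KZ[OF w])
      have "emeasure (G (Z \<omega>)) X = emeasure (K (Z \<omega>)) (Pair (Z \<omega>) -` X \<inter> space (K (Z \<omega>)))"
        unfolding G_def X by (rule emeasure_distr[OF Pair_meas[OF w]]) simp
      also have "Pair (Z \<omega>) -` X \<inter> space (K (Z \<omega>)) = (if Z \<omega> \<in> a then b else {})"
        using sets.sets_into_space[OF ab(2)] sets_eq_imp_space_eq[OF KZ(2)[OF w]] by (auto simp: X)
      finally show "ennreal (indicator a (Z \<omega>) * real_cond_exp M F (\<lambda>\<omega>'. indicator b (Y \<omega>')) \<omega>)
          = emeasure (G (Z \<omega>)) X"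
        unfolding rc by (simp add: K.emeasure_eq_measure)
    qed
    also have "\<dots> = (\<integral>\<^sup>+z. emeasure (G z) X \<partial>distr M B Z)"
      by (rule nn_integral_distr[symmetric, OF ZM])
        (simp add: X measurable_compose[OF measurable_prob_algebraD[OF G] measurable_emeasure_subprob_algebra])
    also have "\<dots> = emeasure ?R X"
      by (rule emeasure_bind_prob_algebra[OF D G, symmetric]) (simp add: X)
    finally show "emeasure ?L X = emeasure ?R X" .
  qed
  then have "(\<integral>\<^sup>+\<omega>. H (Z \<omega>, Y \<omega>) \<partial>M) = (\<integral>\<^sup>+x. H x \<partial>(distr M B Z \<bind> G))"
    using H by (subst nn_integral_distr[symmetric, where f=H]) auto
  also have "\<dots> = (\<integral>\<^sup>+z. (\<integral>\<^sup>+x. H x \<partial>G z) \<partial>distr M B Z)"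
    using measurable_prob_algebraD[OF G] by (intro nn_integral_bind[OF H]) simp
  also have "\<dots> = (\<integral>\<^sup>+\<omega>. (\<integral>\<^sup>+x. H x \<partial>G (Z \<omega>)) \<partial>M)"
    by (rule nn_integral_distr[OF ZM])
      (simp add: measurable_compose[OF measurable_prob_algebraD[OF G] nn_integral_measurable_subprob_algebra[OF H]])
  also have "\<dots> = (\<integral>\<^sup>+\<omega>. (\<integral>\<^sup>+y. H (Z \<omega>, y) \<partial>K (Z \<omega>)) \<partial>M)"
    unfolding G_def by (intro nn_integral_cong nn_integral_distr[OF Pair_meas]) (simp_all add: H)
  finally show ?thesis .
qed

text \<open>Independence says that, restricted to \<open>F\<close>, the measure with density
  \<open>indicator E\<close> is \<open>M\<close> scaled by \<open>prob E\<close>. Integrating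
  \<open>g\<close> against both sides gives the product rule even when the integrals are
  infinite.\<close>

lemma (in prob_space) nn_integral_indep_indicator:
  assumes F: "subalgebra M F" and E: "E \<in> sets M"
    and indep: "\<And>A. A \<in> sets F \<Longrightarrow> prob (E \<inter> A) = prob E * prob A"
    and g: "g \<in> borel_measurable F"
  shows "(\<integral>\<^sup>+\<omega>. indicator E \<omega> * g \<omega> \<partial>M) = ennreal (prob E) * (\<integral>\<^sup>+\<omega>. g \<omega> \<partial>M)"
proof -
  let ?D = "density M (indicator E)"
  have FD: "subalgebra ?D F" using F by (auto simp: subalgebra_def)
  have gM: "g \<in> borel_measurable M" by (rule measurable_from_subalg[OF F g])
  have "restr_to_subalg ?D F = scale_measure (ennreal (prob E)) (restr_to_subalg M F)" (is "?L = ?R")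
  proof (rule measure_eqI)
    show "sets ?L = sets ?R" by (simp add: sets_restr_to_subalg FD F)
    fix A assume "A \<in> sets ?L"
    then have A: "A \<in> sets F" by (simp add: sets_restr_to_subalg FD)
    then have AM: "A \<in> sets M" using F by (auto simp: subalgebra_def)
    have "emeasure ?L A = emeasure ?D A" by (rule emeasure_restr_to_subalg[OF FD A])
    also have "\<dots> = (\<integral>\<^sup>+\<omega>. indicator (E \<inter> A) \<omega> \<partial>M)"
      using E AM by (simp add: emeasure_density indicator_inter_arith)
    also have "\<dots> = ennreal (prob E) * emeasure M A"
      using E AM indep[OF A] by (simp add: emeasure_eq_measure ennreal_mult)
    finally show "emeasure ?L A = emeasure ?R A"
      by (simp add: emeasure_restr_to_subalg[OF F A])
  qed
  then have "(\<integral>\<^sup>+\<omega>. g \<omega> \<partial>?L) = (\<integral>\<^sup>+\<omega>. g \<omega> \<partial>?R)" by simp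
  then show ?thesis
    using E g gM
    by (simp add: nn_integral_subalgebra2[OF FD] nn_integral_subalgebra2[OF F] nn_integral_density
        nn_integral_scale_measure measurable_in_subalg[OF F])
qed

section \<open>Measurability of the sampling laws in the current iterate\<close>

lemma nn_integral_lborel_affine:
  fixes z :: "'a::euclidean_space"
  assumes [measurable]: "F \<in> borel_measurable borel" and h: "0 < h"
  shows "(\<integral>\<^sup>+x. F x \<partial>lborel) = (\<integral>\<^sup>+x. ennreal (h ^ DIM('a)) * F (z + h *\<^sub>R x) \<partial>lborel)"
  using h
  by (subst lborel_affine[of h z])
    (simp_all add: nn_integral_density nn_integral_distr ennreal_power)

lemma adaptive_density_prob_space:
  fixes z :: "real^'d"
  assumes g: "probability_density g" and h: "0 < h"
  shows "prob_space (density lborel (\<lambda>x. ennreal (g ((x - z) /\<^sub>R h) / h ^ CARD('d))))"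
proof (rule prob_spaceI)
  have gm[measurable]: "g \<in> borel_measurable borel" and g0: "\<And>x. 0 \<le> g x"
    and gp: "prob_space (density lborel (\<lambda>x. ennreal (g x)))"
    using g by (auto simp: probability_density_def)
  have "(\<integral>\<^sup>+x. ennreal (g ((x - z) /\<^sub>R h) / h ^ CARD('d)) \<partial>lborel)
      = (\<integral>\<^sup>+x. ennreal (g x) \<partial>lborel)"
    by (subst nn_integral_lborel_affine[OF _ h, of _ z])
      (use h g0 in \<open>auto simp: ennreal_mult[symmetric] intro!: nn_integral_cong\<close>)
  also have "\<dots> = 1"
    using prob_space.emeasure_space_1[OF gp] by (simp add: emeasure_density)
  finally show "emeasure (density lborel (\<lambda>x. ennreal (g ((x - z) /\<^sub>R h) / h ^ CARD('d))))
      (space (density lborel (\<lambda>x. ennreal (g ((x - z) /\<^sub>R h) / h ^ CARD('d))))) = 1"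
    by (simp add: emeasure_density)
qed

text \<open>The design is prescribed at points of \<open>X\<close> only, hence the source space
  \<open>restrict_space borel X\<close>. The static law is a constant kernel; in the adaptive case
  the mass of a set is a parameter integral of a jointly measurable density.\<close>

lemma design_kernel:
  fixes Q :: "nat \<Rightarrow> real^'d \<Rightarrow> (real^'d) measure"
  assumes "static_design X Q \<or> adaptive_design X Q" and k: "1 \<le> k"
  shows "Q k \<in> restrict_space borel X \<rightarrow>\<^sub>M prob_algebra borel"
  using assms(1)
proof
  assume "static_design X Q"
  then obtain g where g: "probability_density g" "\<And>z. z \<in> X \<Longrightarrow> Q k z = density lborel (\<lambda>x. ennreal (g x))"
    using k by (auto simp: static_design_def)
  then have "density lborel (\<lambda>x. ennreal (g x)) \<in> space (prob_algebra borel)"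
    by (simp add: space_prob_algebra probability_density_def)
  then have "(\<lambda>z. density lborel (\<lambda>x. ennreal (g x))) \<in> restrict_space borel X \<rightarrow>\<^sub>M prob_algebra borel"
    by (rule measurable_const)
  then show ?thesis
    by (rule measurable_cong[THEN iffD2, rotated]) (simp add: g space_restrict_space)
next
  assume "adaptive_design X Q"
  then obtain g h where g: "probability_density g" "0 < h"
    "\<And>z. z \<in> X \<Longrightarrow> Q k z = density lborel (\<lambda>x. ennreal (g ((x - z) /\<^sub>R h) / h ^ CARD('d)))"
    using k by (auto simp: adaptive_design_def)
  have [measurable]: "g \<in> borel_measurable borel" using g by (simp add: probability_density_def)
  have "(\<lambda>z. density lborel (\<lambda>x. ennreal (g ((x - z) /\<^sub>R h) / h ^ CARD('d))))
      \<in> (borel :: (real^'d) measure) \<rightarrow>\<^sub>M prob_algebra borel"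
  proof (rule measurable_prob_algebra_generated[where G="sets borel" and \<Omega>=UNIV])
    show "sets (borel :: (real^'d) measure) = sigma_sets UNIV (sets borel)"
      using sets.sigma_sets_eq[of "borel :: (real^'d) measure"] by simp
    show "Int_stable (sets (borel :: (real^'d) measure))" by (rule sets.Int_stable)
    fix A :: "(real^'d) set" assume [measurable]: "A \<in> sets borel"
    show "(\<lambda>z. emeasure (density lborel (\<lambda>x. ennreal (g ((x - z) /\<^sub>R h) / h ^ CARD('d)))) A)
      \<in> borel_measurable borel"
      by (simp add: emeasure_density)
  qed (auto intro: adaptive_density_prob_space g)
  then have "(\<lambda>z. density lborel (\<lambda>x. ennreal (g ((x - z) /\<^sub>R h) / h ^ CARD('d))))
      \<in> restrict_space borel X \<rightarrow>\<^sub>M prob_algebra borel"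
    by (rule measurable_restrict_space1)
  then show ?thesis
    by (rule measurable_cong[THEN iffD2, rotated]) (simp add: g space_restrict_space)
qed

lemma xi_law_kernel:
  fixes c :: "real^'d \<Rightarrow> real^'l"
  assumes nu: "prob_space nu" "sets nu = sets borel" and c[measurable]: "c \<in> borel_measurable borel"
  shows "xi_law c nu \<in> borel \<rightarrow>\<^sub>M prob_algebra borel"
proof -
  have "nu \<in> space (prob_algebra borel)" using nu by (simp add: space_prob_algebra)
  then show ?thesis
    unfolding xi_law_def[abs_def]
    by (intro measurable_distr_prob_space2[where M=borel] measurable_const) simp_all
qed

lemma batch_law_kernel:
  fixes c :: "real^'d \<Rightarrow> real^'l"
  assumes "prob_space nu" "sets nu = sets borel" "c \<in> borel_measurable borel"
  shows "batch_law c nu m \<in> borel \<rightarrow>\<^sub>M prob_algebra (PiM {..<m} (\<lambda>_. borel))"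
  unfolding batch_law_def[abs_def]
  by (intro measurable_PiM_prob_algebra xi_law_kernel assms) simp

lemma data_law_kernel:
  fixes c :: "real^'d \<Rightarrow> real^'l"
  assumes "prob_space nu" "sets nu = sets borel" "c \<in> borel_measurable borel"
    and "static_design X Q \<or> adaptive_design X Q" and "1 \<le> n"
  shows "data_law c nu Q n \<in> restrict_space borel X \<rightarrow>\<^sub>M prob_algebra (PiM {..<n} (\<lambda>_. borel))"
  unfolding data_law_def[abs_def]
  by (intro measurable_PiM_prob_algebra measurable_bind_prob_space[OF design_kernel[OF assms(4,5)]]
      measurable_distr_prob_space2[OF xi_law_kernel[OF assms(1-3)]]) (simp_all add: borel_prod)

text \<open>This is how exchangeability enters the stability argument: a batch with one entry
  replaced by an independent copy has the law of the original batch.\<close>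

lemma distr_PiM_update:
  assumes P: "prob_space P" and i: "i \<in> I"
  shows "distr (P \<Otimes>\<^sub>M PiM I (\<lambda>_. P)) (PiM I (\<lambda>_. P)) (\<lambda>(x, w). w(i := x)) = PiM I (\<lambda>_. P)"
  using distr_pair_PiM_eq_PiM[of I "\<lambda>_. P" i] P i by (simp add: insert_absorb)

section \<open>Stability of regularised empirical minimisers\<close>

lemma average_lipschitz:
  fixes psi :: "'a::metric_space \<Rightarrow> 'b \<Rightarrow> real"
  assumes "\<And>e. L-lipschitz_on X (\<lambda>x. psi x e)" and m: "0 < m"
  shows "L-lipschitz_on X (\<lambda>x. 1 / real m * (\<Sum>i<m. psi x (w i)))"
proof (rule lipschitz_onI)
  fix x y assume xy: "x \<in> X" "y \<in> X"
  have "\<bar>(\<Sum>i<m. psi x (w i)) - (\<Sum>i<m. psi y (w i))\<bar> \<le> (\<Sum>i<m. \<bar>psi x (w i) - psi y (w i)\<bar>)"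
    unfolding sum_subtractf[symmetric] by (rule sum_abs)
  also have "\<dots> \<le> (\<Sum>i<m. L * dist x y)"
    using lipschitz_onD[OF assms(1) xy] by (intro sum_mono) (simp add: dist_real_def)
  finally have "\<bar>(\<Sum>i<m. psi x (w i)) - (\<Sum>i<m. psi y (w i))\<bar> \<le> real m * (L * dist x y)"
    by simp
  then have "\<bar>(\<Sum>i<m. psi x (w i)) - (\<Sum>i<m. psi y (w i))\<bar> / real m \<le> real m * (L * dist x y) / real m"
    by (rule divide_right_mono) simp
  then show "dist (1 / real m * (\<Sum>i<m. psi x (w i))) (1 / real m * (\<Sum>i<m. psi y (w i)))
      \<le> L * dist x y"
    using m by (simp add: dist_real_def flip: diff_divide_distrib)
qed (rule lipschitz_on_nonneg[OF assms(1)])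

lemma average_weakly_convex:
  fixes psi :: "'a::real_inner \<Rightarrow> 'b \<Rightarrow> real"
  assumes wc: "\<And>e. weakly_convex_on X k (\<lambda>x. psi x e)" and m: "0 < m"
  shows "weakly_convex_on X k (\<lambda>x. 1 / real m * (\<Sum>i<m. psi x (w i)))"
proof (rule weakly_convex_onI)
  show "convex X" using wc by (auto simp: weakly_convex_on_def convex_on_def)
  fix x y and s :: real
  assume xy: "x \<in> X" "y \<in> X" "0 < s" "s < 1"
  let ?q = "(1 - s) *\<^sub>R x + s *\<^sub>R y"
  have "(\<Sum>i<m. psi ?q (w i))
      \<le> (\<Sum>i<m. (1 - s) * psi x (w i) + s * psi y (w i) + k / 2 * (s * (1 - s) * (norm (x - y))\<^sup>2))"
    using weakly_convex_onD[OF wc xy(1,2), of s] xy(3,4) by (intro sum_mono) simp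
  also have "\<dots> = (1 - s) * (\<Sum>i<m. psi x (w i)) + s * (\<Sum>i<m. psi y (w i))
      + real m * (k / 2 * (s * (1 - s) * (norm (x - y))\<^sup>2))"
    by (simp add: sum.distrib sum_distrib_left)
  finally have "(\<Sum>i<m. psi ?q (w i)) / real m \<le> \<dots> / real m"
    using m by (simp add: divide_right_mono)
  then show "1 / real m * (\<Sum>i<m. psi ?q (w i)) \<le> (1 - s) * (1 / real m * (\<Sum>i<m. psi x (w i)))
      + s * (1 / real m * (\<Sum>i<m. psi y (w i))) + k / 2 * (s * (1 - s) * (norm (x - y))\<^sup>2)"
    using m by (simp add: add_divide_distrib)
qed

text \<open>Replacing one observation by a fresh one moves the minimiser by at most
  \<^term>\<open>2 * L / (m * (al - k))\<close>, and by exchangeability the gap is an average of such differences.\<close>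

lemma generalization_gap:
  fixes psi :: "'a::euclidean_space \<Rightarrow> 'b \<Rightarrow> real"
  assumes X: "closed X" and a: "a \<in> X" and al: "0 < al" "k < al" and m: "0 < m"
    and P: "prob_space P"
    and lip: "\<And>e. L-lipschitz_on X (\<lambda>x. psi x e)"
    and wc: "\<And>e. weakly_convex_on X k (\<lambda>x. psi x e)"
    and int: "integrable P (psi a)"
    and p: "\<And>w. p w = prox X (\<lambda>x. 1 / real m * (\<Sum>i<m. psi x (w i))) al a"
    and meas: "(\<lambda>(e, w). psi (p w) e) \<in> borel_measurable (P \<Otimes>\<^sub>M PiM {..<m} (\<lambda>_. P))"
  shows "integrable (PiM {..<m} (\<lambda>_. P))
      (\<lambda>w. (\<integral>e. psi (p w) e \<partial>P) - 1 / real m * (\<Sum>i<m. psi (p w) (w i)))" (is ?int)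
    and "(\<integral>w. (\<integral>e. psi (p w) e \<partial>P) - 1 / real m * (\<Sum>i<m. psi (p w) (w i)) \<partial>PiM {..<m} (\<lambda>_. P))
      \<le> 2 * L\<^sup>2 / (real m * (al - k))" (is ?le)
proof -
  let ?W = "PiM {..<m} (\<lambda>_. P)"
  let ?g = "\<lambda>w x. 1 / real m * (\<Sum>i<m. psi x (w i))"
  interpret P: prob_space P by fact
  interpret W: prob_space ?W by (rule prob_space_PiM) (rule P)
  interpret PW: pair_sigma_finite P ?W ..
  interpret PWp: prob_space "P \<Otimes>\<^sub>M ?W" by (rule prob_space_pair) (unfold_locales)
  have L: "0 \<le> L" using lip by (rule lipschitz_on_nonneg)
  have g_lip: "L-lipschitz_on X (?g w)" for w by (rule average_lipschitz[OF lip m])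
  have g_wc: "weakly_convex_on X k (?g w)" for w by (rule average_weakly_convex[OF wc m])
  have pmin: "is_arg_min (\<lambda>x. ?g w x + al / 2 * (norm (x - a))\<^sup>2) (\<lambda>x. x \<in> X) (p w)" for w
    unfolding p by (rule prox_is_arg_min[OF X g_lip al(1) a])
  then have pX: "p w \<in> X" for w by (simp add: is_arg_min_def)
  \<comment> \<open>The bound is uniform in the batch \<open>w\<close>; with \<open>psi a\<close>
    integrable it supplies the domination for every integral below.\<close>
  have bound: "\<bar>psi (p w) e\<bar> \<le> \<bar>psi a e\<bar> + L * (2 * L / al)" for w e
  proof -
    have "\<bar>psi (p w) e - psi a e\<bar> \<le> L * norm (p w - a)"
      using lipschitz_onD[OF lip pX a] by (simp add: dist_norm)
    also have "\<dots> \<le> L * (2 * L / al)"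
      using is_arg_min_displacement[OF g_lip al(1) a pmin] L by (rule mult_left_mono)
    finally show ?thesis by linarith
  qed
  have int_psi: "integrable P (psi (p w))" if "w \<in> space ?W" for w
  proof (rule Bochner_Integration.integrable_bound)
    show "integrable P (\<lambda>e. \<bar>psi a e\<bar> + L * (2 * L / al))" using int by simp
    show "psi (p w) \<in> borel_measurable P"
      using measurable_compose[OF measurable_Pair2'[OF that] meas] by simp
  qed (use bound[of w] L al in \<open>auto intro: AE_I2 order_trans[OF _ abs_ge_self]\<close>)
  have [measurable]: "psi a \<in> borel_measurable P" using int by simp
  have snd_int: "integrable (P \<Otimes>\<^sub>M ?W) (\<lambda>(e, w). \<bar>psi a e\<bar> + L * (2 * L / al))"
    using int by (intro PW.Fubini_integrable) (simp_all add: case_prod_beta)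
  have int_pair: "integrable (P \<Otimes>\<^sub>M ?W) (\<lambda>(e, w). psi (p w) e)"
    using snd_int meas
    by (rule Bochner_Integration.integrable_bound) (use bound in \<open>auto intro!: AE_I2 order_trans[OF _ abs_ge_self]\<close>)
  note pop = PW.integral_snd[OF int_pair] PW.integrable_snd[OF int_pair]
  have comp: "distr ?W P (\<lambda>w. w i) = P" if "i < m" for i
    using distr_PiM_component[of "{..<m}" "\<lambda>_. P" i] P that by simp
  have emp_meas: "(\<lambda>w. psi (p w) (w i)) \<in> borel_measurable ?W" if i: "i < m" for i
  proof -
    have "(\<lambda>w. (w i, w)) \<in> ?W \<rightarrow>\<^sub>M P \<Otimes>\<^sub>M ?W"
      by (rule measurable_Pair[OF measurable_component_singleton measurable_ident_sets[OF refl]])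
        (use i in simp)
    from measurable_compose[OF this meas] show ?thesis by simp
  qed
  have emp_int: "integrable ?W (\<lambda>w. psi (p w) (w i))" if i: "i < m" for i
  proof (rule Bochner_Integration.integrable_bound)
    have "(\<lambda>w. w i) \<in> ?W \<rightarrow>\<^sub>M P" by (rule measurable_component_singleton) (use i in simp)
    moreover have "integrable (distr ?W P (\<lambda>w. w i)) (psi a)" using int comp[OF i] by simp
    ultimately have "integrable ?W (\<lambda>w. psi a (w i))" by (rule integrable_distr)
    then show "integrable ?W (\<lambda>w. \<bar>psi a (w i)\<bar> + L * (2 * L / al))" by simp
  qed (use emp_meas[OF i] bound in \<open>auto intro!: AE_I2 order_trans[OF _ abs_ge_self]\<close>)
  have emp_int': "integrable ?W (\<lambda>w. \<Sum>i<m. psi (p w) (w i))"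
    using emp_int by (intro Bochner_Integration.integrable_sum) simp
  show ?int using pop(2) emp_int' by (intro Bochner_Integration.integrable_diff integrable_mult_right) simp_all
  have each: "(\<integral>w. (\<integral>e. psi (p w) e \<partial>P) \<partial>?W) - (\<integral>w. psi (p w) (w i) \<partial>?W)
      \<le> 2 * L\<^sup>2 / (real m * (al - k))" if i: "i < m" for i
  proof -
    let ?u = "\<lambda>(e, w). w(i := e)"
    have upd: "distr (P \<Otimes>\<^sub>M ?W) ?W ?u = ?W" by (rule distr_PiM_update[OF P]) (use i in simp)
    have u_meas: "?u \<in> P \<Otimes>\<^sub>M ?W \<rightarrow>\<^sub>M ?W"
      using i measurable_fun_upd[of "{..<m}" "{..<m}" i snd "P \<Otimes>\<^sub>M ?W" "\<lambda>_. P" fst]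
      by (simp add: insert_absorb case_prod_beta')
    \<comment> \<open>After the replacement, the loss at coordinate \<open>i\<close> is that of the
      perturbed minimiser at \<open>e\<close>, while the population term is the loss of
      \<open>p w\<close> at the same \<open>e\<close>. Two minimisers are thus compared on one
      observation.\<close>
    have eq: "(\<integral>w. psi (p w) (w i) \<partial>?W) = (\<integral>x. psi (p (?u x)) (?u x i) \<partial>(P \<Otimes>\<^sub>M ?W))"
      by (subst upd[symmetric], rule integral_distr[OF u_meas]) (rule emp_meas[OF i])
    have "integrable (distr (P \<Otimes>\<^sub>M ?W) ?W ?u) (\<lambda>w. psi (p w) (w i))"
      unfolding upd by (rule emp_int[OF i])
    then have int_u: "integrable (P \<Otimes>\<^sub>M ?W) (\<lambda>x. psi (p (?u x)) (?u x i))"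
      by (rule integrable_distr[OF u_meas])
    have "psi (p w) e - psi (p (w(i := e))) e \<le> 2 * L\<^sup>2 / (real m * (al - k))" for e w
    proof -
      \<comment> \<open>The two averages differ in a single summand, hence the factor
        \<open>1 / m\<close>; the second factor \<open>L\<close> of the bound comes from evaluating
        \<open>psi\<close> at the two minimisers.\<close>
      have "(2 * L / real m)-lipschitz_on X (\<lambda>x. ?g w x - ?g (w(i := e)) x)"
      proof (rule lipschitz_onI)
        fix x y assume xy: "x \<in> X" "y \<in> X"
        have diff: "?g w x - ?g (w(i := e)) x = (psi x (w i) - psi x e) / real m" for x
          using i by (simp add: sum.remove[of "{..<m}" i] diff_divide_distrib add_divide_distrib)
        have "\<bar>(psi x (w i) - psi x e) - (psi y (w i) - psi y e)\<bar> \<le> 2 * (L * dist x y)"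
          using lipschitz_onD[OF lip xy, of "w i"] lipschitz_onD[OF lip xy, of e]
          unfolding dist_real_def by linarith
        then show "dist (?g w x - ?g (w(i := e)) x) (?g w y - ?g (w(i := e)) y) \<le> 2 * L / real m * dist x y"
          unfolding diff dist_real_def using m
          by (simp add: field_simps flip: diff_divide_distrib)
      qed (use L in simp)
      from prox_stable[OF X al a g_lip[of w] g_lip[of "w(i := e)"] g_wc g_wc this]
      have "norm (p w - p (w(i := e))) \<le> 2 * L / real m / (al - k)"
        unfolding p .
      then have "L * norm (p w - p (w(i := e))) \<le> L * (2 * L / real m / (al - k))"
        by (rule mult_left_mono[OF _ L])
      moreover have "psi (p w) e - psi (p (w(i := e))) e \<le> L * norm (p w - p (w(i := e)))"
        using lipschitz_onD[OF lip pX[of w] pX[of "w(i := e)"], of e]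
        by (simp add: dist_norm)
      ultimately show ?thesis by (simp add: power2_eq_square mult.left_commute)
    qed
    then have "(\<integral>x. (case x of (e, w) \<Rightarrow> psi (p w) e) - psi (p (?u x)) (?u x i) \<partial>(P \<Otimes>\<^sub>M ?W))
        \<le> (\<integral>x. 2 * L\<^sup>2 / (real m * (al - k)) \<partial>(P \<Otimes>\<^sub>M ?W))"
      by (intro integral_mono Bochner_Integration.integrable_diff int_pair int_u) auto
    then show ?thesis
      unfolding pop(1) eq by (simp add: Bochner_Integration.integral_diff[OF int_pair int_u] PWp.prob_space)
  qed
  have "(\<integral>w. (\<integral>e. psi (p w) e \<partial>P) - 1 / real m * (\<Sum>i<m. psi (p w) (w i)) \<partial>?W)
      = (\<integral>w. (\<integral>e. psi (p w) e \<partial>P) \<partial>?W) - 1 / real m * (\<Sum>i<m. (\<integral>w. psi (p w) (w i) \<partial>?W))"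
    using pop(2) emp_int emp_int'
    by (simp add: Bochner_Integration.integral_diff Bochner_Integration.integral_sum)
  also have "\<dots> = 1 / real m * (\<Sum>i<m. (\<integral>w. (\<integral>e. psi (p w) e \<partial>P) \<partial>?W) - (\<integral>w. psi (p w) (w i) \<partial>?W))"
    using m by (simp add: sum_subtractf field_simps)
  also have "\<dots> \<le> 1 / real m * (\<Sum>i<m. 2 * L\<^sup>2 / (real m * (al - k)))"
    using each by (intro mult_left_mono sum_mono) auto
  also have "\<dots> = 2 * L\<^sup>2 / (real m * (al - k))" using m by simp
  finally show ?le .
qed

text \<open>Here \<open>r\<close> and \<open>s\<close> are the distances from the base point to the
  target and to the next iterate, \<open>q\<close> is the distance between these two,
  \<open>K\<close> stands for \<open>lphi * Lc\<close> and \<open>d\<close> for the scaled Jacobian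
  error. Adding the four inequalities leaves \<open>(al + rho - tau) / 2\<close> at
  \<open>q\<^sup>2\<close>, \<open>- (al - rho - K) / 2\<close> at \<open>s\<^sup>2\<close>, and at
  \<open>r\<^sup>2\<close> half the difference of \<open>al + rho - tau\<close> and
  \<open>2 * rho - K - tau\<close>. The linear terms are then absorbed by Young's
  inequality.\<close>

lemma descent_arithmetic:
  fixes al rho tau K lh lt d r s q fz fp Fz Fp Gz Gp :: real
  assumes 1: "Fp + al / 2 * s\<^sup>2 + (al - lh) / 2 * q\<^sup>2 \<le> Fz + al / 2 * r\<^sup>2"
    and 2: "fz + rho / 2 * r\<^sup>2 + (rho - (K + lt)) / 2 * q\<^sup>2 \<le> fp + rho / 2 * s\<^sup>2"
    and 3: "Gz - fz \<le> K / 2 * r\<^sup>2 + d * r" and 4: "fp - Gp \<le> K / 2 * s\<^sup>2 + d * s"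
    and tau: "tau = K + lh + lt" and B: "0 < 2 * rho - K - tau" and E: "0 < al - rho - K"
    and N: "0 < al + rho - tau" and rho: "0 < rho"
  shows "rho / 2 * q\<^sup>2 + rho * (2 * rho - K - tau) / (4 * (al + rho - tau)) * r\<^sup>2
    \<le> rho / 2 * r\<^sup>2 + rho / (al + rho - tau) *
        ((Fz - Gz) + (Gp - Fp) + (d\<^sup>2 / (2 * rho - K - tau) + d\<^sup>2 / (2 * (al - rho - K))))"
proof -
  let ?N = "al + rho - tau" and ?B = "2 * rho - K - tau" and ?E = "al - rho - K"
  let ?R = "(Fz - Gz) + (Gp - Fp) + (d\<^sup>2 / ?B + d\<^sup>2 / (2 * ?E))"
  \<comment> \<open>This weight uses up the whole negative coefficient of
    \<open>s\<^sup>2\<close>.\<close>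
  have s: "d * s \<le> ?E / 2 * s\<^sup>2 + d\<^sup>2 / (2 * ?E)"
  proof -
    have "0 \<le> (?E * s - d)\<^sup>2 / (2 * ?E)" using E by simp
    also have "\<dots> = ?E / 2 * s\<^sup>2 + d\<^sup>2 / (2 * ?E) - d * s"
      using E by (simp add: power2_diff power_mult_distrib field_simps) (simp add: power2_eq_square algebra_simps)
    finally show ?thesis by simp
  qed
  \<comment> \<open>Only half of the coefficient \<open>?B / 2\<close> is spent here; the other half
    remains as the decrease.\<close>
  have r: "d * r \<le> ?B / 4 * r\<^sup>2 + d\<^sup>2 / ?B"
  proof -
    have "0 \<le> (?B * r - 2 * d)\<^sup>2 / (4 * ?B)" using B by simp
    also have "\<dots> = ?B / 4 * r\<^sup>2 + d\<^sup>2 / ?B - d * r"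
      using B by (simp add: power2_diff power_mult_distrib field_simps) (simp add: power2_eq_square algebra_simps)
    finally show ?thesis by simp
  qed
  have "?N / 2 * q\<^sup>2 + ?B / 4 * r\<^sup>2 \<le> ?N / 2 * r\<^sup>2 + ?R"
    using 1 2 3 4 s r unfolding tau by (simp add: algebra_simps diff_divide_distrib add_divide_distrib)
  then have "rho / ?N * (?N / 2 * q\<^sup>2 + ?B / 4 * r\<^sup>2) \<le> rho / ?N * (?N / 2 * r\<^sup>2 + ?R)"
    using N rho by (intro mult_left_mono) auto
  moreover have "rho / ?N * (?N / 2 * q\<^sup>2 + ?B / 4 * r\<^sup>2) = rho / 2 * q\<^sup>2 + rho * ?B / (4 * ?N) * r\<^sup>2"
    using N by (simp add: field_simps)
  moreover have "rho / ?N * (?N / 2 * r\<^sup>2 + ?R) = rho / 2 * r\<^sup>2 + rho / ?N * ?R"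
  proof -
    have "rho / n * (n / 2 * x) = rho / 2 * x" if "0 < n" for n x :: real using that by simp
    then show ?thesis using N by (simp only: distrib_left)
  qed
  ultimately show ?thesis by simp
qed

section \<open>The objective and its linearised models\<close>

locale spl_problem =
  fixes X U :: "(real^'d) set"
    and phi :: "(real^'d) \<times> (real^'l) \<Rightarrow> real"
    and c :: "real^'d \<Rightarrow> real^'l"
    and nu :: "(real^'l) measure"
    and lam lphi lc Lc :: real
  assumes X: "X \<noteq> {}" "closed X" "convex X" and U: "open U" "convex U" "X \<subseteq> U"
    and lam: "0 \<le> lam" and phi_wc: "weakly_convex_on (U \<times> UNIV) lam phi"
    and phi_lip: "lphi-lipschitz_on (U \<times> UNIV) phi"
    and nu: "prob_space nu" "sets nu = sets borel" "integrable nu (\<lambda>e. (norm e)\<^sup>2)"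
    and c_lip: "lc-lipschitz_on U c" and c_diff: "c differentiable_on U"
    and c_jac: "\<forall>x\<in>U. \<forall>y\<in>U. mat_norm (jacobian c (at x) - jacobian c (at y)) \<le> Lc * norm (x - y)"
    and c_meas: "c \<in> borel_measurable borel"
begin

abbreviation f :: "real^'d \<Rightarrow> real" where "f \<equiv> objective phi c nu"

lemma XU: "x \<in> X \<Longrightarrow> x \<in> U" using U(3) by auto

lemma lphi_nonneg: "0 \<le> lphi" by (rule lipschitz_on_nonneg[OF phi_lip])

lemma lc_nonneg: "0 \<le> lc" by (rule lipschitz_on_nonneg[OF c_lip])

text \<open>The open set \<open>U\<close> contains two distinct points, and there the Jacobian
  inequality bounds a nonnegative number by \<open>Lc\<close> times a positive one.\<close>

lemma Lc_nonneg: "0 \<le> Lc"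
proof -
  obtain x where x: "x \<in> U" using X(1) U(3) by auto
  then obtain r where r: "0 < r" "ball x r \<subseteq> U" using U(1) open_contains_ball by blast
  obtain v :: "real^'d" where v: "norm v = r / 2" using vector_choose_size[of "r / 2"] r(1) by auto
  then have "x + v \<in> U" using r by (auto simp: dist_norm)
  then have "mat_norm (jacobian c (at (x + v)) - jacobian c (at x)) \<le> Lc * norm v"
    using c_jac x by fastforce
  then have "0 \<le> Lc * norm v" using mat_norm_nonneg order_trans by blast
  then show ?thesis using v r(1) by (simp add: zero_le_mult_iff)
qed

lemma nu_integrable_norm: "integrable nu norm"
proof -
  interpret prob_space nu by (rule nu)
  show ?thesis
    by (rule square_integrable_imp_integrable[OF _ nu(3)])
      (simp add: measurable_cong_sets[OF nu(2) refl])
qed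

lemma nu_measurable: "(g \<in> nu \<rightarrow>\<^sub>M N) = (g \<in> borel \<rightarrow>\<^sub>M N)"
  by (simp add: measurable_cong_sets[OF nu(2) refl])

lemma phi_diff_le:
  assumes "x \<in> U" "y \<in> U"
  shows "\<bar>phi (x, u) - phi (y, v)\<bar> \<le> lphi * (norm (x - y) + norm (u - v))"
proof -
  have "\<bar>phi (x, u) - phi (y, v)\<bar> \<le> lphi * norm (x - y, u - v)"
    using lipschitz_onD[OF phi_lip, of "(x, u)" "(y, v)"] assms by (simp add: dist_norm)
  also have "\<dots> \<le> lphi * (norm (x - y) + norm (u - v))"
    by (intro mult_left_mono norm_Pair_le lphi_nonneg)
  finally show ?thesis .
qed

text \<open>If the second argument moves at most \<open>b\<close> times as far as the first, the
  joint displacement is at most \<open>1 + b\<close> times that of the first. This is the origin of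
  both \<open>lamt\<close>, with \<open>b = lc\<close>, and \<open>lamh\<close>, with
  \<open>b = lchat\<close>.\<close>

lemma phi_convex_combination:
  assumes "x \<in> U" "y \<in> U" "0 \<le> s" "s \<le> 1" and b: "norm (u - v) \<le> b * norm (x - y)"
  shows "phi ((1 - s) *\<^sub>R x + s *\<^sub>R y, (1 - s) *\<^sub>R u + s *\<^sub>R v)
    \<le> (1 - s) * phi (x, u) + s * phi (y, v) + lam * (1 + b)\<^sup>2 / 2 * (s * (1 - s) * (norm (x - y))\<^sup>2)"
proof -
  have "norm (x - y, u - v) \<le> (1 + b) * norm (x - y)"
    using norm_Pair_le[of "x - y" "u - v"] b by (simp add: algebra_simps)
  then have "(norm (x - y, u - v))\<^sup>2 \<le> ((1 + b) * norm (x - y))\<^sup>2"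
    by (rule power_mono) simp
  then have "lam / 2 * (s * (1 - s) * (norm (x - y, u - v))\<^sup>2)
      \<le> lam / 2 * (s * (1 - s) * ((1 + b) * norm (x - y))\<^sup>2)"
    using assms lam by (intro mult_left_mono) auto
  also have "\<dots> = lam * (1 + b)\<^sup>2 / 2 * (s * (1 - s) * (norm (x - y))\<^sup>2)"
    by (simp add: power_mult_distrib)
  finally show ?thesis
    using weakly_convex_onD[OF phi_wc, of "(x, u)" "(y, v)" s] assms by simp
qed

lemma phi_measurable:
  assumes g: "g \<in> N \<rightarrow>\<^sub>M borel" "\<And>w. w \<in> space N \<Longrightarrow> g w \<in> U" and k: "k \<in> N \<rightarrow>\<^sub>M borel"
  shows "(\<lambda>w. phi (g w, k w)) \<in> borel_measurable N"
proof -
  have "(\<lambda>w. (g w, k w)) \<in> N \<rightarrow>\<^sub>M restrict_space borel (U \<times> UNIV)"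
    using assms by (intro measurable_restrict_space2) (auto simp: borel_prod[symmetric])
  moreover have "phi \<in> borel_measurable (restrict_space borel (U \<times> UNIV))"
    by (intro borel_measurable_continuous_on_restrict lipschitz_on_continuous_on[OF phi_lip])
  ultimately show ?thesis by (rule measurable_compose)
qed

lemma phi_integrable:
  assumes x: "x \<in> U"
  shows "integrable nu (\<lambda>e. phi (x, v + e))"
proof (rule Bochner_Integration.integrable_bound)
  interpret prob_space nu by (rule nu)
  show "integrable nu (\<lambda>e. \<bar>phi (x, 0)\<bar> + lphi * (norm v + norm e))"
    using nu_integrable_norm by simp
  show "(\<lambda>e. phi (x, v + e)) \<in> borel_measurable nu"
    unfolding nu_measurable by (rule phi_measurable) (use x in auto)
  have "\<bar>phi (x, v + e)\<bar> \<le> \<bar>phi (x, 0)\<bar> + lphi * (norm v + norm e)" for e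
  proof -
    have "lphi * norm (v + e) \<le> lphi * (norm v + norm e)"
      by (intro mult_left_mono norm_triangle_ineq lphi_nonneg)
    then show ?thesis using phi_diff_le[OF x x, of "v + e" 0] by simp
  qed
  then show "AE e in nu. norm (phi (x, v + e)) \<le> norm (\<bar>phi (x, 0)\<bar> + lphi * (norm v + norm e))"
    by (intro AE_I2) (auto intro: order_trans[OF _ abs_ge_self])
qed

lemma linear_model_lipschitz:
  assumes "mat_norm A \<le> b"
  shows "(lphi * (1 + b))-lipschitz_on X (\<lambda>x. phi (x, w + A *v (x - a)))"
proof (rule lipschitz_onI)
  have "0 \<le> b" using assms mat_norm_nonneg order_trans by blast
  then show "0 \<le> lphi * (1 + b)" using lphi_nonneg by simp
  fix x y assume xy: "x \<in> X" "y \<in> X"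
  have "norm (A *v (x - y)) \<le> b * norm (x - y)"
    using mat_norm_mult_vec[of A "x - y"] mult_right_mono[OF assms, of "norm (x - y)"] by simp
  then have "lphi * (norm (x - y) + norm (A *v (x - y))) \<le> lphi * (norm (x - y) + b * norm (x - y))"
    by (intro mult_left_mono lphi_nonneg) simp
  moreover have "w + A *v (x - a) - (w + A *v (y - a)) = A *v (x - y)"
    by (simp add: matrix_vector_mult_diff_distrib)
  ultimately show "dist (phi (x, w + A *v (x - a))) (phi (y, w + A *v (y - a))) \<le> lphi * (1 + b) * dist x y"
    using phi_diff_le[OF XU[OF xy(1)] XU[OF xy(2)], of "w + A *v (x - a)" "w + A *v (y - a)"]
    by (simp add: dist_real_def dist_norm[of x y] algebra_simps)
qed

text \<open>The inner map is affine, so convex combinations pass through it exactly and the modulus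
  has no contribution from \<open>Lc\<close>.\<close>

lemma linear_model_weakly_convex:
  assumes "mat_norm A \<le> b"
  shows "weakly_convex_on X (lam * (1 + b)\<^sup>2) (\<lambda>x. phi (x, w + A *v (x - a)))"
proof (rule weakly_convex_onI[OF X(3)])
  fix x y and s :: real
  assume xy: "x \<in> X" "y \<in> X" "0 < s" "s < 1"
  have "w + A *v ((1 - s) *\<^sub>R x + s *\<^sub>R y - a)
      = (1 - s) *\<^sub>R (w + A *v (x - a)) + s *\<^sub>R (w + A *v (y - a))"
    by (simp add: matrix_vector_mult_diff_distrib matrix_vector_right_distrib matrix_vector_mult_scaleR
        algebra_simps)
  moreover have "norm ((w + A *v (x - a)) - (w + A *v (y - a))) \<le> b * norm (x - y)"
    using mat_norm_mult_vec[of A "x - y"] mult_right_mono[OF assms, of "norm (x - y)"]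
    by (simp add: matrix_vector_mult_diff_distrib)
  ultimately show "phi ((1 - s) *\<^sub>R x + s *\<^sub>R y, w + A *v ((1 - s) *\<^sub>R x + s *\<^sub>R y - a))
      \<le> (1 - s) * phi (x, w + A *v (x - a)) + s * phi (y, w + A *v (y - a))
        + lam * (1 + b)\<^sup>2 / 2 * (s * (1 - s) * (norm (x - y))\<^sup>2)"
    using phi_convex_combination[OF XU[OF xy(1)] XU[OF xy(2)], of s] xy(3,4) by simp
qed

section \<open>Regularity of the objective and of the Jacobian\<close>

lemma objective_lipschitz: "(lphi * (1 + lc))-lipschitz_on X f"
proof (rule lipschitz_onI)
  show "0 \<le> lphi * (1 + lc)" using lphi_nonneg lc_nonneg by simp
  interpret prob_space nu by (rule nu)
  fix x y assume xy: "x \<in> X" "y \<in> X"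
  note xyU = XU[OF xy(1)] XU[OF xy(2)]
  have "norm (c x - c y) \<le> lc * norm (x - y)"
    using lipschitz_onD[OF c_lip xyU] by (simp add: dist_norm)
  then have *: "lphi * (norm (x - y) + norm (c x - c y)) \<le> lphi * (norm (x - y) + lc * norm (x - y))"
    by (intro mult_left_mono lphi_nonneg) simp
  have "\<bar>\<integral>e. phi (x, c x + e) - phi (y, c y + e) \<partial>nu\<bar> \<le> (\<integral>e. lphi * (1 + lc) * dist x y \<partial>nu)"
    unfolding real_norm_def[symmetric]
  proof (rule order_trans[OF integral_norm_bound integral_mono])
    fix e
    show "norm (phi (x, c x + e) - phi (y, c y + e)) \<le> lphi * (1 + lc) * dist x y"
      using phi_diff_le[OF xyU, of "c x + e" "c y + e"] * by (simp add: dist_norm algebra_simps)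
  qed (use phi_integrable xyU in auto)
  then show "dist (f x) (f y) \<le> lphi * (1 + lc) * dist x y"
    by (simp add: objective_def dist_real_def phi_integrable xyU prob_space)
qed

lemma taylor:
  "x \<in> U \<Longrightarrow> y \<in> U \<Longrightarrow> norm (c y - c x - jacobian c (at x) *v (y - x)) \<le> Lc / 2 * (norm (y - x))\<^sup>2"
  by (rule jacobian_taylor[OF U(1,2) c_diff c_jac])

text \<open>Two defects add up: \<open>phi\<close> contributes
  \<open>lam * (1 + lc)\<^sup>2\<close>, and the distance of \<open>c\<close> at a convex
  combination from the combination of its values contributes \<open>lphi * Lc\<close> through the
  Lipschitz constant of \<open>phi\<close>.\<close>

lemma objective_weakly_convex: "weakly_convex_on X (lphi * Lc + lam * (1 + lc)\<^sup>2) f"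
proof (rule weakly_convex_onI[OF X(3)])
  interpret prob_space nu by (rule nu)
  fix x y and s :: real
  assume xy: "x \<in> X" "y \<in> X" "0 < s" "s < 1"
  note xyU = XU[OF xy(1)] XU[OF xy(2)]
  let ?q = "(1 - s) *\<^sub>R x + s *\<^sub>R y" and ?D = "s * (1 - s) * (norm (x - y))\<^sup>2"
  have q: "?q \<in> U" using X(3) xy XU by (simp add: convex_alt)
  have "x - ?q = s *\<^sub>R (x - y)" "y - ?q = (s - 1) *\<^sub>R (x - y)" by (simp_all add: algebra_simps)
  then have xq: "norm (x - ?q) = s * norm (x - y)" and yq: "norm (y - ?q) = (1 - s) * norm (x - y)"
    using xy(3,4) by simp_all
  have scale: "norm (t *\<^sub>R u) \<le> t * b" if "0 \<le> t" "norm u \<le> b" for t b and u :: "real^'l"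
    using that by (simp add: mult_left_mono)
  \<comment> \<open>Both values of \<open>c\<close> are expanded about the combination
    \<open>?q\<close>. The weighted displacements from \<open>?q\<close> sum to zero, so the
    Jacobian terms cancel and only Taylor remainders are left.\<close>
  have ceq: "c ?q - ((1 - s) *\<^sub>R c x + s *\<^sub>R c y)
      = - ((1 - s) *\<^sub>R (c x - c ?q - jacobian c (at ?q) *v (x - ?q))
        + s *\<^sub>R (c y - c ?q - jacobian c (at ?q) *v (y - ?q)))"
  proof -
    have "(1 - s) *\<^sub>R (x - ?q) + s *\<^sub>R (y - ?q) = 0" by (simp add: algebra_simps)
    then have "jacobian c (at ?q) *v ((1 - s) *\<^sub>R (x - ?q) + s *\<^sub>R (y - ?q)) = 0" by simp
    then show ?thesis
      by (simp add: matrix_vector_right_distrib matrix_vector_mult_scaleR algebra_simps)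
  qed
  have "norm (c ?q - ((1 - s) *\<^sub>R c x + s *\<^sub>R c y))
      \<le> (1 - s) * (Lc / 2 * (norm (x - ?q))\<^sup>2) + s * (Lc / 2 * (norm (y - ?q))\<^sup>2)"
    unfolding ceq norm_minus_cancel
    by (intro norm_triangle_le add_mono scale taylor[OF q] xyU) (use xy in auto)
  also have "\<dots> = Lc / 2 * ?D"
    unfolding xq yq power_mult_distrib by (simp add: power2_eq_square field_simps)
  finally have cq: "lphi * norm (c ?q - ((1 - s) *\<^sub>R c x + s *\<^sub>R c y)) \<le> lphi * (Lc / 2 * ?D)"
    by (rule mult_left_mono[OF _ lphi_nonneg])
  have cxy: "norm (c x - c y) \<le> lc * norm (x - y)"
    using lipschitz_onD[OF c_lip xyU] by (simp add: dist_norm)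
  have pt: "phi (?q, c ?q + e) \<le> (1 - s) * phi (x, c x + e) + s * phi (y, c y + e)
      + (lphi * Lc + lam * (1 + lc)\<^sup>2) / 2 * ?D" for e
  proof -
    let ?u = "(1 - s) *\<^sub>R (c x + e) + s *\<^sub>R (c y + e)"
    have eq: "c ?q + e - ?u = c ?q - ((1 - s) *\<^sub>R c x + s *\<^sub>R c y)" by (simp add: algebra_simps)
    have "phi (?q, c ?q + e) - phi (?q, ?u) \<le> lphi * norm (c ?q + e - ?u)"
      using phi_diff_le[OF q q, of "c ?q + e" ?u] by simp
    also have "\<dots> \<le> lphi * (Lc / 2 * ?D)" unfolding eq by (rule cq)
    finally have "phi (?q, c ?q + e) \<le> phi (?q, ?u) + lphi * (Lc / 2 * ?D)" by simp
    moreover have "phi (?q, ?u) \<le> (1 - s) * phi (x, c x + e) + s * phi (y, c y + e)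
        + lam * (1 + lc)\<^sup>2 / 2 * ?D"
      by (rule phi_convex_combination[OF xyU]) (use xy cxy in auto)
    ultimately show ?thesis by (simp add: algebra_simps add_divide_distrib)
  qed
  have "f ?q \<le> (\<integral>e. (1 - s) * phi (x, c x + e) + s * phi (y, c y + e)
      + (lphi * Lc + lam * (1 + lc)\<^sup>2) / 2 * ?D \<partial>nu)"
    unfolding objective_def using pt
    by (intro integral_mono) (simp_all add: phi_integrable xyU q)
  then show "f ?q \<le> (1 - s) * f x + s * f y + (lphi * Lc + lam * (1 + lc)\<^sup>2) / 2 * ?D"
    by (simp add: objective_def phi_integrable xyU prob_space)
qed

text \<open>Difference quotients are bounded by \<open>lc\<close>, and the Taylor remainder divided
  by the step tends to 0. The bound makes the supremum in \<open>e1\<close> one over a bounded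
  set.\<close>

lemma mat_norm_jacobian_le:
  assumes x: "x \<in> U"
  shows "mat_norm (jacobian c (at x)) \<le> lc"
proof (rule mat_norm_le)
  fix v
  obtain r where r: "0 < r" "ball x r \<subseteq> U" using x U(1) open_contains_ball by blast
  let ?J = "jacobian c (at x)"
  show "norm (?J *v v) \<le> lc * norm v"
  proof (cases "v = 0")
    case False
    \<comment> \<open>The step keeps the displacement at most \<open>r / 2\<close>, hence strictly
      inside the ball, for every \<open>k\<close>.\<close>
    let ?s = "\<lambda>k. r / (2 * norm v) / real (Suc k)"
    have "norm (?J *v v) \<le> lc * norm v + Lc / 2 * (norm v)\<^sup>2 * ?s k" for k
    proof -
      define s where "s = ?s k"
      have s: "0 < s" using r(1) False by (simp add: s_def)
      have "s \<le> r / (2 * norm v)"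
        unfolding s_def using r(1) False divide_left_mono[of 1 "real (Suc k)" "r / (2 * norm v)"] by simp
      then have "norm (s *\<^sub>R v) < r" using s r(1) False by (simp add: field_simps)
      then have y: "x + s *\<^sub>R v \<in> U" using r(2) by (auto simp: dist_norm)
      have "norm (s *\<^sub>R (?J *v v)) \<le> norm (c (x + s *\<^sub>R v) - c x)
          + norm (c (x + s *\<^sub>R v) - c x - ?J *v (s *\<^sub>R v))"
        using norm_triangle_ineq4[of "c (x + s *\<^sub>R v) - c x" "c (x + s *\<^sub>R v) - c x - ?J *v (s *\<^sub>R v)"]
        by (simp add: matrix_vector_mult_scaleR)
      also have "\<dots> \<le> lc * norm (s *\<^sub>R v) + Lc / 2 * (norm (s *\<^sub>R v))\<^sup>2"
        using lipschitz_onD[OF c_lip y x] taylor[OF x y] by (intro add_mono) (auto simp: dist_norm)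
      finally have "s * norm (?J *v v) \<le> s * (lc * norm v + Lc / 2 * (norm v)\<^sup>2 * s)"
        using s by (simp add: power_mult_distrib power2_eq_square algebra_simps)
      then show ?thesis using s unfolding s_def[symmetric] by simp
    qed
    moreover have "(\<lambda>k. lc * norm v + Lc / 2 * (norm v)\<^sup>2 * ?s k)
        \<longlonglongrightarrow> lc * norm v + Lc / 2 * (norm v)\<^sup>2 * 0"
      by (intro tendsto_add tendsto_mult tendsto_const LIMSEQ_Suc[OF lim_const_over_n])
    ultimately show ?thesis
      using LIMSEQ_le_const[of _ "lc * norm v" "norm (?J *v v)"] by auto
  qed simp
qed

end

section \<open>One step of the method\<close>

locale spl_algorithm = spl_problem X U phi c nu lam lphi lc Lc
  for X U :: "(real^'d) set"
    and phi :: "(real^'d) \<times> (real^'l) \<Rightarrow> real"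
    and c :: "real^'d \<Rightarrow> real^'l"
    and nu :: "(real^'l) measure"
    and lam lphi lc Lc :: real +
  fixes lchat lamt lamh tau rho :: real
    and zmin :: "real^'d"
    and Q :: "nat \<Rightarrow> real^'d \<Rightarrow> (real^'d) measure"
    and est :: "nat \<Rightarrow> real^'d \<Rightarrow> (nat \<Rightarrow> (real^'d) \<times> (real^'l)) \<Rightarrow> real^'d^'l"
  assumes design: "static_design X Q \<or> adaptive_design X Q"
    and estimator: "measurable_estimator X est"
    and est_bound: "\<forall>k\<ge>1. \<forall>y\<in>X. AE D in data_law c nu Q k y. mat_norm (est k y D) \<le> lchat"
    and lamt: "lamt = lam * (1 + lc)\<^sup>2"
    and lamh: "lamh = lam * (1 + lchat)\<^sup>2"
    and tau: "tau = lphi * Lc + lamh + lamt"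
    and rho: "rho > lphi * Lc + max lamt lamh"
    and zmin: "is_arg_min (objective phi c nu) (\<lambda>x. x \<in> X) zmin"
begin

text \<open>Clipping changes the estimate on a null set only; it makes every subproblem strongly convex,
  so that the minimiser is unique and depends measurably on the samples.\<close>

definition clipped :: "nat \<Rightarrow> real^'d \<Rightarrow> (nat \<Rightarrow> (real^'d) \<times> (real^'l)) \<Rightarrow> real^'d^'l" where
  "clipped n a D = (if mat_norm (est n a D) \<le> lchat then est n a D else 0)"

definition model_prox :: "nat \<Rightarrow> real \<Rightarrow> (nat \<Rightarrow> real^'l) \<Rightarrow> real^'d^'l \<Rightarrow> real^'d \<Rightarrow> real^'d" where
  "model_prox m al w A a = prox X (empirical_model phi m w A a) al a"

text \<open>The mean of the sampled model for a frozen matrix \<open>A\<close>: it separates the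
  sampling error, empirical against mean, from the linearisation error, mean against
  \<open>f\<close>.\<close>

definition model_mean :: "real^'d^'l \<Rightarrow> real^'d \<Rightarrow> real^'d \<Rightarrow> real" where
  "model_mean A a x = (\<integral>e. phi (x, e + A *v (x - a)) \<partial>xi_law c nu a)"

definition target :: "real^'d \<Rightarrow> real^'d" where
  "target a = prox X f rho a"

definition gap :: "real^'d \<Rightarrow> real" where
  "gap a = moreau X f rho a - f zmin"

text \<open>A quarter of the bracket in the final bound: the stability term, then the two Young
  remainders at the target and at the next iterate.\<close>

definition noise :: "real \<Rightarrow> nat \<Rightarrow> nat \<Rightarrow> real" where
  "noise al m n = 2 * lphi\<^sup>2 * (1 + lchat)\<^sup>2 / (real m * (al - lamh))
    + (lphi\<^sup>2 * (e1 X c nu Q est n)\<^sup>2 / (2 * rho - lphi * Lc - tau)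
      + lphi\<^sup>2 * (e1 X c nu Q est n)\<^sup>2 / (2 * (al - rho - lphi * Lc)))"

lemma data_law_space:
  assumes "1 \<le> n" "a \<in> X"
  shows "prob_space (data_law c nu Q n a)"
    "sets (data_law c nu Q n a) = sets (PiM {..<n} (\<lambda>_. borel))"
  using measurable_space[OF data_law_kernel[OF nu(1,2) c_meas design assms(1)], of a] assms(2)
  by (auto simp: space_prob_algebra space_restrict_space)

lemma batch_law_space:
  "prob_space (batch_law c nu m a)"
  "sets (batch_law c nu m a) = sets (PiM {..<m} (\<lambda>_. borel))"
  using measurable_space[OF batch_law_kernel[OF nu(1,2) c_meas], of a]
  by (auto simp: space_prob_algebra)

lemma xi_law_space: "prob_space (xi_law c nu a)" "sets (xi_law c nu a) = sets borel"
  using measurable_space[OF xi_law_kernel[OF nu(1,2) c_meas], of a]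
  by (auto simp: space_prob_algebra)

text \<open>This makes the zero matrix an admissible default in \<open>clipped\<close>.\<close>

lemma lchat_nonneg: "0 \<le> lchat"
proof -
  obtain a where a: "a \<in> X" using X(1) by auto
  interpret D: prob_space "data_law c nu Q 1 a" by (rule data_law_space) (use a in auto)
  have "AE D in data_law c nu Q 1 a. mat_norm (est 1 a D) \<le> lchat"
    using est_bound a by blast
  then have "AE D in data_law c nu Q 1 a. 0 \<le> lchat"
    by eventually_elim (use mat_norm_nonneg order_trans in blast)
  then show ?thesis by simp
qed

text \<open>Positivity of the last constant holds because \<open>2 * rho - lphi * Lc - tau\<close>
  is the sum of \<open>rho - lphi * Lc - lamt\<close> and
  \<open>rho - lphi * Lc - lamh\<close>.\<close>

lemma constants:
  "0 \<le> lphi * Lc" "0 \<le> lamt" "0 \<le> lamh" "0 < rho" "lphi * Lc + lamt < rho"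
  "0 < 2 * rho - lphi * Lc - tau"
proof -
  show K: "0 \<le> lphi * Lc" using lphi_nonneg Lc_nonneg by simp
  show "0 \<le> lamt" "0 \<le> lamh" unfolding lamt lamh using lam by auto
  then show "0 < rho" "lphi * Lc + lamt < rho" "0 < 2 * rho - lphi * Lc - tau"
    using rho K unfolding tau by linarith+
qed

lemma step_constants:
  assumes "al > rho + lphi * Lc"
  shows "0 < al" "lamh < al" "0 < al - rho - lphi * Lc" "0 < al + rho - tau"
  using assms constants rho unfolding tau by linarith+

section \<open>The proximal point and the envelope gap of the objective\<close>

lemma target_min: "a \<in> X \<Longrightarrow>
    is_arg_min (\<lambda>x. f x + rho / 2 * (norm (x - a))\<^sup>2) (\<lambda>x. x \<in> X) (target a)"
  unfolding target_def by (rule prox_is_arg_min[OF X(2) objective_lipschitz constants(4)])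

lemma target_in: "a \<in> X \<Longrightarrow> target a \<in> X"
  using target_min by (simp add: is_arg_min_def)

lemma gap_eq: "a \<in> X \<Longrightarrow> gap a = f (target a) + rho / 2 * (norm (target a - a))\<^sup>2 - f zmin"
  unfolding gap_def by (simp add: moreau_eq_prox[OF target_min])

lemma gap_le:
  assumes "a \<in> X" "y \<in> X"
  shows "gap a \<le> f y + rho / 2 * (norm (y - a))\<^sup>2 - f zmin"
  using target_min[OF assms(1)] assms(2) unfolding gap_eq[OF assms(1)] by (force simp: is_arg_min_def)

lemma gap_nonneg: "a \<in> X \<Longrightarrow> 0 \<le> gap a"
proof -
  assume a: "a \<in> X"
  have "f zmin \<le> f (target a)" using zmin target_in[OF a] by (force simp: is_arg_min_def)
  moreover have "0 \<le> rho / 2 * (norm (target a - a))\<^sup>2" using constants(4) by simp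
  ultimately show ?thesis unfolding gap_eq[OF a] by linarith
qed

lemma target_measurable: "target \<in> borel_measurable (restrict_space borel X)"
proof (rule borel_measurable_argmin[where X=X and h="\<lambda>a x. f x + rho / 2 * (norm (x - a))\<^sup>2"
      and mu="(rho - (lphi * Lc + lamt)) / 2"])
  fix a assume "a \<in> space (restrict_space borel X)"
  then have a: "a \<in> X" by (simp add: space_restrict_space)
  show "continuous_on X (\<lambda>x. f x + rho / 2 * (norm (x - a))\<^sup>2)"
    by (intro continuous_intros lipschitz_on_continuous_on[OF objective_lipschitz])
  show "target a \<in> X" by (rule target_in[OF a])
  fix x assume "x \<in> X"
  from is_arg_min_growth[OF objective_weakly_convex target_min[OF a] this]
  show "f (target a) + rho / 2 * (norm (target a - a))\<^sup>2 + (rho - (lphi * Lc + lamt)) / 2 * (dist x (target a))\<^sup>2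
      \<le> f x + rho / 2 * (norm (x - a))\<^sup>2"
    by (simp add: dist_norm lamt)
next
  fix x
  have "(\<lambda>a. f x + rho / 2 * (norm (x - a))\<^sup>2) \<in> borel_measurable borel" by measurable
  then show "(\<lambda>a. f x + rho / 2 * (norm (x - a))\<^sup>2) \<in> borel_measurable (restrict_space borel X)"
    by (rule measurable_restrict_space1)
qed (use constants(5) in simp)

lemma ident_measurable: "(\<lambda>a. a) \<in> borel_measurable (restrict_space borel X)"
  by (rule measurable_restrict_space1) simp

lemma gap_measurable: "gap \<in> borel_measurable (restrict_space borel X)"
proof -
  note [measurable] = target_measurable ident_measurable
  have "f \<in> borel_measurable (restrict_space borel X)"
    by (intro borel_measurable_continuous_on_restrict lipschitz_on_continuous_on[OF objective_lipschitz])
  moreover have "target \<in> restrict_space borel X \<rightarrow>\<^sub>M restrict_space borel X"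
    using target_measurable target_in by (intro measurable_restrict_space2) (auto simp: space_restrict_space)
  ultimately have [measurable]: "(\<lambda>a. f (target a)) \<in> borel_measurable (restrict_space borel X)"
    by (rule measurable_compose[rotated])
  have "(\<lambda>a. f (target a) + rho / 2 * (norm (target a - a))\<^sup>2 - f zmin) \<in> borel_measurable (restrict_space borel X)"
    by measurable
  then show ?thesis
    by (rule measurable_cong[THEN iffD2, rotated]) (simp add: gap_eq space_restrict_space)
qed

section \<open>The sampled subproblem for one batch size and one proximal parameter\<close>

context
  fixes m :: nat and al :: real
  assumes m: "1 \<le> m" and al: "al > rho + lphi * Lc"
begin

lemma empirical_lipschitz:
  assumes "mat_norm A \<le> lchat"
  shows "(lphi * (1 + lchat))-lipschitz_on X (empirical_model phi m w A a)"
  unfolding empirical_model_def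
  by (rule average_lipschitz[OF linear_model_lipschitz[OF assms]]) (use m in simp)

lemma empirical_weakly_convex:
  assumes "mat_norm A \<le> lchat"
  shows "weakly_convex_on X lamh (empirical_model phi m w A a)"
  unfolding empirical_model_def lamh
  by (rule average_weakly_convex[OF linear_model_weakly_convex[OF assms]]) (use m in simp)

lemma model_prox_min:
  assumes "a \<in> X" "mat_norm A \<le> lchat"
  shows "is_arg_min (\<lambda>x. empirical_model phi m w A a x + al / 2 * (norm (x - a))\<^sup>2) (\<lambda>x. x \<in> X)
    (model_prox m al w A a)"
  unfolding model_prox_def
  by (rule prox_is_arg_min[OF X(2) empirical_lipschitz[OF assms(2)] step_constants(1)[OF al] assms(1)])

lemma model_prox_in: "a \<in> X \<Longrightarrow> mat_norm A \<le> lchat \<Longrightarrow> model_prox m al w A a \<in> X"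
  using model_prox_min by (simp add: is_arg_min_def)

text \<open>Base point, matrix and batch are all functions on an arbitrary space \<open>N\<close>.
  This covers a random batch with the rest frozen as well as the full step map on iterates, batches
  and data sets.\<close>

lemma model_prox_measurable:
  assumes a: "a \<in> borel_measurable N" "\<And>v. v \<in> space N \<Longrightarrow> a v \<in> X"
    and A: "A \<in> borel_measurable N" "\<And>v. v \<in> space N \<Longrightarrow> mat_norm (A v) \<le> lchat"
    and w: "\<And>i. i < m \<Longrightarrow> (\<lambda>v. w v i) \<in> borel_measurable N"
  shows "(\<lambda>v. model_prox m al (w v) (A v) (a v)) \<in> N \<rightarrow>\<^sub>M restrict_space borel X"
proof (rule measurable_restrict_space2)
  show "(\<lambda>v. model_prox m al (w v) (A v) (a v)) \<in> space N \<rightarrow> X"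
    using model_prox_in a(2) A(2) by auto
  note [measurable] = a(1) A(1)
  show "(\<lambda>v. model_prox m al (w v) (A v) (a v)) \<in> borel_measurable N"
  proof (rule borel_measurable_argmin[where X=X and mu="(al - lamh) / 2"
        and h="\<lambda>v x. empirical_model phi m (w v) (A v) (a v) x + al / 2 * (norm (x - a v))\<^sup>2"])
    fix x assume x: "x \<in> X"
    have [measurable]: "(\<lambda>v. A v *v (x - a v)) \<in> borel_measurable N"
    proof -
      have "continuous_on UNIV (\<lambda>p :: (real^'d^'l) \<times> (real^'d). fst p *v snd p)"
        unfolding matrix_vector_mult_def
        by (intro continuous_intros)
      then have mv: "(\<lambda>p :: (real^'d^'l) \<times> (real^'d). fst p *v snd p) \<in> borel_measurable borel"
        by (rule borel_measurable_continuous_onI)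
      have "(\<lambda>v. (A v, x - a v)) \<in> borel_measurable N" by measurable
      from measurable_compose[OF this mv] show ?thesis by simp
    qed
    have [measurable]: "(\<lambda>v. phi (x, w v i + A v *v (x - a v))) \<in> borel_measurable N" if "i < m" for i
      using w[OF that] XU[OF x] by (intro phi_measurable borel_measurable_add) auto
    have [measurable]: "(\<lambda>v. \<Sum>i<m. phi (x, w v i + A v *v (x - a v))) \<in> borel_measurable N"
      by (rule borel_measurable_sum) simp
    show "(\<lambda>v. empirical_model phi m (w v) (A v) (a v) x + al / 2 * (norm (x - a v))\<^sup>2) \<in> borel_measurable N"
      unfolding empirical_model_def by measurable
  next
    fix v assume v: "v \<in> space N"
    show "continuous_on X (\<lambda>x. empirical_model phi m (w v) (A v) (a v) x + al / 2 * (norm (x - a v))\<^sup>2)"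
      by (intro continuous_intros lipschitz_on_continuous_on[OF empirical_lipschitz[OF A(2)[OF v]]])
    show "model_prox m al (w v) (A v) (a v) \<in> X" by (intro model_prox_in a A v)
    fix x assume "x \<in> X"
    from is_arg_min_growth[OF empirical_weakly_convex[OF A(2)[OF v]] model_prox_min[OF a(2)[OF v] A(2)[OF v]] this]
    show "empirical_model phi m (w v) (A v) (a v) (model_prox m al (w v) (A v) (a v))
        + al / 2 * (norm (model_prox m al (w v) (A v) (a v) - a v))\<^sup>2
        + (al - lamh) / 2 * (dist x (model_prox m al (w v) (A v) (a v)))\<^sup>2
      \<le> empirical_model phi m (w v) (A v) (a v) x + al / 2 * (norm (x - a v))\<^sup>2"
      by (simp add: dist_norm)
  qed (use step_constants(2)[OF al] in simp)
qed

lemma model_integrable: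
  assumes "x \<in> X"
  shows "integrable (xi_law c nu a) (\<lambda>e. phi (x, e + v))"
proof -
  have "(\<lambda>e. c a + e) \<in> nu \<rightarrow>\<^sub>M borel" by (simp add: nu_measurable)
  moreover have "(\<lambda>e. phi (x, e + v)) \<in> borel_measurable borel"
    by (rule phi_measurable) (use XU assms in auto)
  ultimately show ?thesis
    using phi_integrable[OF XU[OF assms], of "c a + v"]
    by (simp add: xi_law_def integrable_distr_eq algebra_simps)
qed

text \<open>At equal noise the two integrands differ only in the second argument of
  \<open>phi\<close>. Its change is the Taylor remainder, quadratic in the displacement, plus the
  Jacobian error, linear in it.\<close>

lemma model_mean_error:
  assumes a: "a \<in> X" and x: "x \<in> X"
  shows "\<bar>model_mean A a x - f x\<bar>
    \<le> lphi * Lc / 2 * (norm (x - a))\<^sup>2 + lphi * mat_norm (A - jacobian c (at a)) * norm (x - a)"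
proof -
  interpret prob_space nu by (rule nu)
  let ?J = "jacobian c (at a)"
  let ?b = "lphi * Lc / 2 * (norm (x - a))\<^sup>2 + lphi * mat_norm (A - ?J) * norm (x - a)"
  have mean: "model_mean A a x = (\<integral>e. phi (x, c a + A *v (x - a) + e) \<partial>nu)"
    unfolding model_mean_def xi_law_def
    by (subst integral_distr) (use XU x in \<open>auto simp: nu_measurable algebra_simps intro!: phi_measurable\<close>)
  have "norm (c a + A *v (x - a) - c x)
      \<le> norm ((A - ?J) *v (x - a)) + norm (c x - c a - ?J *v (x - a))"
    using norm_triangle_ineq4[of "(A - ?J) *v (x - a)" "c x - c a - ?J *v (x - a)"]
    by (simp add: matrix_vector_mult_diff_rdistrib algebra_simps)
  also have "\<dots> \<le> mat_norm (A - ?J) * norm (x - a) + Lc / 2 * (norm (x - a))\<^sup>2"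
    by (intro add_mono mat_norm_mult_vec taylor XU a x)
  finally have "lphi * norm (c a + A *v (x - a) - c x)
      \<le> lphi * (mat_norm (A - ?J) * norm (x - a) + Lc / 2 * (norm (x - a))\<^sup>2)"
    by (rule mult_left_mono[OF _ lphi_nonneg])
  then have pt: "norm (phi (x, c a + A *v (x - a) + e) - phi (x, c x + e)) \<le> ?b" for e
    using phi_diff_le[OF XU[OF x] XU[OF x], of "c a + A *v (x - a) + e" "c x + e"]
    by (simp add: algebra_simps)
  have "norm (\<integral>e. phi (x, c a + A *v (x - a) + e) - phi (x, c x + e) \<partial>nu) \<le> (\<integral>e. ?b \<partial>nu)"
    by (rule order_trans[OF integral_norm_bound integral_mono])
      (use pt phi_integrable[OF XU[OF x]] in auto)
  then show ?thesis
    unfolding mean objective_def by (simp add: phi_integrable XU x prob_space)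
qed

text \<open>The bound holds for every batch and keeps the two sampling errors with their signs: in
  expectation the one at \<open>target a\<close> vanishes, and the one at \<open>p\<close> is
  controlled by stability.\<close>

lemma pointwise_descent:
  fixes w :: "nat \<Rightarrow> real^'l"
  assumes a: "a \<in> X" and A: "mat_norm A \<le> lchat"
  defines "p \<equiv> model_prox m al w A a" and "d \<equiv> lphi * mat_norm (A - jacobian c (at a))"
  shows "gap p + rho * (2 * rho - lphi * Lc - tau) / (4 * (al + rho - tau)) * (norm (target a - a))\<^sup>2
    \<le> gap a + rho / (al + rho - tau) *
      ((empirical_model phi m w A a (target a) - model_mean A a (target a))
        + (model_mean A a p - empirical_model phi m w A a p)
        + (d\<^sup>2 / (2 * rho - lphi * Lc - tau) + d\<^sup>2 / (2 * (al - rho - lphi * Lc))))"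
proof -
  let ?F = "empirical_model phi m w A a" and ?G = "model_mean A a" and ?z = "target a"
  have p: "p \<in> X" unfolding p_def by (rule model_prox_in[OF a A])
  have z: "?z \<in> X" by (rule target_in[OF a])
  have 1: "?F p + al / 2 * (norm (p - a))\<^sup>2 + (al - lamh) / 2 * (norm (?z - p))\<^sup>2
      \<le> ?F ?z + al / 2 * (norm (?z - a))\<^sup>2"
    unfolding p_def by (rule is_arg_min_growth[OF empirical_weakly_convex[OF A] model_prox_min[OF a A] z])
  have 2: "f ?z + rho / 2 * (norm (?z - a))\<^sup>2 + (rho - (lphi * Lc + lamt)) / 2 * (norm (?z - p))\<^sup>2
      \<le> f p + rho / 2 * (norm (p - a))\<^sup>2"
    using is_arg_min_growth[OF objective_weakly_convex target_min[OF a] p]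
    by (simp add: lamt norm_minus_commute)
  have 3: "?G ?z - f ?z \<le> lphi * Lc / 2 * (norm (?z - a))\<^sup>2 + d * norm (?z - a)"
    using model_mean_error[OF a z, of A] unfolding d_def by linarith
  have 4: "f p - ?G p \<le> lphi * Lc / 2 * (norm (p - a))\<^sup>2 + d * norm (p - a)"
    using model_mean_error[OF a p, of A] unfolding d_def by linarith
  from descent_arithmetic[OF 1 2 3 4 tau constants(6) step_constants(3,4)[OF al] constants(4)]
  show ?thesis
    \<comment> \<open>The envelope at \<open>p\<close> is bounded by the competitor
      \<open>target a\<close>, so that \<open>f (target a)\<close> cancels against
      \<open>gap a\<close>.\<close>
    using gap_le[OF p z] unfolding gap_eq[OF a] by linarith
qed

end

text \<open>The matrix \<open>A\<close> is deterministic here. Freezing the data set in this way is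
  legitimate since it is independent of the batch given the current iterate.\<close>

lemma batch_descent:
  assumes m: "1 \<le> m" and al: "al > rho + lphi * Lc" and a: "a \<in> X" and A: "mat_norm A \<le> lchat"
  defines "d \<equiv> lphi * mat_norm (A - jacobian c (at a))"
  shows "(\<integral>\<^sup>+w. ennreal (gap (model_prox m al w A a)) \<partial>batch_law c nu m a)
      + ennreal (rho * (2 * rho - lphi * Lc - tau) / (4 * (al + rho - tau)) * (norm (target a - a))\<^sup>2)
    \<le> ennreal (gap a + rho / (al + rho - tau) *
        (2 * lphi\<^sup>2 * (1 + lchat)\<^sup>2 / (real m * (al - lamh))
          + (d\<^sup>2 / (2 * rho - lphi * Lc - tau) + d\<^sup>2 / (2 * (al - rho - lphi * Lc)))))"
    (is "_ + ennreal ?cr \<le> ennreal (gap a + ?k * (?st + ?C))")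
proof -
  let ?P = "xi_law c nu a" and ?W = "batch_law c nu m a"
  let ?psi = "\<lambda>x e. phi (x, e + A *v (x - a))"
  let ?p = "\<lambda>w. model_prox m al w A a"
  let ?F = "\<lambda>w. empirical_model phi m w A a" and ?G = "model_mean A a" and ?z = "target a"
  note al' = step_constants[OF al]
  have W: "?W = PiM {..<m} (\<lambda>_. ?P)" by (simp add: batch_law_def)
  interpret P: prob_space ?P by (rule xi_law_space)
  interpret W: prob_space ?W by (rule batch_law_space)
  have z: "?z \<in> X" by (rule target_in[OF a])
  have p_meas: "?p \<in> ?W \<rightarrow>\<^sub>M restrict_space borel X"
  proof (rule model_prox_measurable[OF m al])
    fix i assume "i < m"
    then show "(\<lambda>w. w i) \<in> borel_measurable ?W"
      unfolding measurable_cong_sets[OF batch_law_space(2) refl]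
      by (intro measurable_component_singleton) simp
  qed (use a A in auto)
  have psi_meas: "(\<lambda>(e, w). ?psi (?p w) e) \<in> borel_measurable (?P \<Otimes>\<^sub>M PiM {..<m} (\<lambda>_. ?P))"
    unfolding case_prod_beta
  proof (rule phi_measurable)
    have p: "(\<lambda>x. ?p (snd x)) \<in> ?P \<Otimes>\<^sub>M PiM {..<m} (\<lambda>_. ?P) \<rightarrow>\<^sub>M restrict_space borel X"
      using measurable_compose[OF measurable_snd p_meas] by (simp add: W)
    then show pb: "(\<lambda>x. ?p (snd x)) \<in> borel_measurable (?P \<Otimes>\<^sub>M PiM {..<m} (\<lambda>_. ?P))"
      by (rule measurable_compose[OF _ ident_measurable])
    show "?p (snd x) \<in> U" for x :: "(real^'l) \<times> (nat \<Rightarrow> real^'l)"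
      using model_prox_in[OF m al a A] XU by auto
    have fstm: "fst \<in> borel_measurable (?P \<Otimes>\<^sub>M PiM {..<m} (\<lambda>_. ?P))"
      using measurable_cong_sets[OF refl xi_law_space(2)] measurable_fst by blast
    have "(\<lambda>v. A *v v) \<in> borel_measurable borel"
      by (intro borel_measurable_continuous_onI linear_continuous_on) (simp add: linear_linear)
    then have "(\<lambda>x. A *v (?p (snd x) - a)) \<in> borel_measurable (?P \<Otimes>\<^sub>M PiM {..<m} (\<lambda>_. ?P))"
      by (rule measurable_compose[rotated]) (intro borel_measurable_diff pb borel_measurable_const)
    then show "(\<lambda>x. fst x + A *v (?p (snd x) - a)) \<in> borel_measurable (?P \<Otimes>\<^sub>M PiM {..<m} (\<lambda>_. ?P))"
      by (intro borel_measurable_add fstm)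
  qed
  have m0: "0 < m" using m by simp
  have p_eq: "?p w = prox X (\<lambda>x. 1 / real m * (\<Sum>i<m. ?psi x (w i))) al a" for w
    by (simp add: model_prox_def empirical_model_def[abs_def])
  note gen = generalization_gap[OF X(2) a al'(1,2) m0 P.prob_space_axioms
      linear_model_lipschitz[OF A] linear_model_weakly_convex[OF A, folded lamh]
      model_integrable[OF m al a] p_eq psi_meas, folded W empirical_model_def model_mean_def]
  have comp: "integrable ?W (\<lambda>w. ?psi ?z (w i))" "(\<integral>w. ?psi ?z (w i) \<partial>?W) = ?G ?z" if i: "i < m" for i
  proof -
    have d: "distr ?W ?P (\<lambda>w. w i) = ?P"
      unfolding W using distr_PiM_component[of "{..<m}" "\<lambda>_. ?P" i] xi_law_space i by simp
    have meas: "(\<lambda>w. w i) \<in> ?W \<rightarrow>\<^sub>M ?P"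
      unfolding W by (intro measurable_component_singleton) (use i in simp)
    have int: "integrable ?P (?psi ?z)" by (rule model_integrable[OF m al z])
    show "integrable ?W (\<lambda>w. ?psi ?z (w i))"
      by (rule integrable_distr[OF meas]) (unfold d, rule int)
    have "(\<integral>w. ?psi ?z (w i) \<partial>?W) = (\<integral>e. ?psi ?z e \<partial>distr ?W ?P (\<lambda>w. w i))"
      by (rule integral_distr[OF meas, symmetric]) (use int in simp)
    then show "(\<integral>w. ?psi ?z (w i) \<partial>?W) = ?G ?z" by (simp add: d model_mean_def)
  qed
  have Fz_int: "integrable ?W (\<lambda>w. ?F w ?z)"
    unfolding empirical_model_def using comp(1)
    by (intro integrable_mult_right Bochner_Integration.integrable_sum) simp
  \<comment> \<open>The target does not depend on the batch, so the sampled model is unbiased at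
    it.\<close>
  have Fz: "(\<integral>w. ?F w ?z \<partial>?W) = ?G ?z"
    unfolding empirical_model_def using comp m0
    by (simp add: Bochner_Integration.integral_sum)
  let ?R = "\<lambda>w. gap a + ?k * ((?F w ?z - ?G ?z) + (?G (?p w) - ?F w (?p w)) + ?C)"
  have affine: "integrable ?W (\<lambda>w. q + k * ((u w - b) + v w + C))"
    "(\<integral>w. q + k * ((u w - b) + v w + C) \<partial>?W) = q + k * (((\<integral>w. u w \<partial>?W) - b) + (\<integral>w. v w \<partial>?W) + C)"
    if "integrable ?W u" "integrable ?W v" for u v :: "_ \<Rightarrow> real" and q k b C
    using that by (simp_all add: W.prob_space)
  have R_int: "integrable ?W ?R" by (rule affine(1)[OF Fz_int gen(1)])
  have k: "0 \<le> ?k" using al'(4) constants(4) by simp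
  have "(\<integral>w. ?R w \<partial>?W) = gap a + ?k * ((\<integral>w. ?G (?p w) - ?F w (?p w) \<partial>?W) + ?C)"
    by (rule trans[OF affine(2)[OF Fz_int gen(1)]]) (simp only: Fz diff_self add_0_left)
  also have "\<dots> \<le> gap a + ?k * (2 * (lphi * (1 + lchat))\<^sup>2 / (real m * (al - lamh)) + ?C)"
    by (intro add_left_mono mult_left_mono add_right_mono gen(2) k)
  finally have R_le: "(\<integral>w. ?R w \<partial>?W) \<le> gap a + ?k * (?st + ?C)"
    by (simp add: power_mult_distrib mult.assoc)
  have cr: "0 \<le> ?cr" using constants(4,6) al'(4) by simp
  have gap_p: "0 \<le> gap (?p w)" for w by (rule gap_nonneg[OF model_prox_in[OF m al a A]])
  have pd: "gap (?p w) + ?cr \<le> ?R w" for w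
    unfolding d_def by (rule pointwise_descent[OF m al a A])
  have "(\<integral>\<^sup>+w. ennreal (gap (?p w)) \<partial>?W) + ennreal ?cr
      = (\<integral>\<^sup>+w. ennreal (gap (?p w)) + ennreal ?cr \<partial>?W)"
    using measurable_compose[OF p_meas gap_measurable]
    by (subst nn_integral_add) (simp_all add: W.emeasure_space_1)
  also have "\<dots> \<le> (\<integral>\<^sup>+w. ennreal (?R w) \<partial>?W)"
  proof (rule nn_integral_mono)
    fix w
    show "ennreal (gap (?p w)) + ennreal ?cr \<le> ennreal (?R w)"
      unfolding ennreal_plus[OF gap_p cr, symmetric] by (rule ennreal_leI[OF pd])
  qed
  \<comment> \<open>The signed sampling errors in \<open>?R\<close> are harmless for the extended
    integral: by \<open>pd\<close> the whole expression dominates a nonnegative quantity.\<close>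
  also have "\<dots> = ennreal (\<integral>w. ?R w \<partial>?W)"
  proof (rule nn_integral_eq_integral[OF R_int], rule AE_I2)
    fix w
    show "0 \<le> ?R w"
      using pd[of w] gap_p[of w] cr by linarith
  qed
  also have "\<dots> \<le> ennreal (gap a + ?k * (?st + ?C))"
    using R_le by (rule ennreal_leI)
  finally show ?thesis .
qed

section \<open>The estimation error and the integrated step\<close>

lemma clipped_le: "mat_norm (clipped n a D) \<le> lchat"
  using lchat_nonneg by (simp add: clipped_def)

lemma est_measurable:
  "1 \<le> n \<Longrightarrow> (\<lambda>(a, D). est n a D) \<in> borel_measurable (restrict_space borel X \<Otimes>\<^sub>M PiM {..<n} (\<lambda>_. borel))"
  using estimator by (simp add: measurable_estimator_def)

lemma clipped_measurable:
  assumes "1 \<le> n"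
  shows "(\<lambda>(a, D). clipped n a D) \<in> borel_measurable (restrict_space borel X \<Otimes>\<^sub>M PiM {..<n} (\<lambda>_. borel))"
proof -
  note [measurable] = est_measurable[OF assms]
  show ?thesis unfolding clipped_def by measurable
qed

lemma data_section:
  assumes "a \<in> X" "(\<lambda>(a, D). g a D) \<in> restrict_space borel X \<Otimes>\<^sub>M PiM {..<n} (\<lambda>_. borel) \<rightarrow>\<^sub>M N"
    and "1 \<le> n"
  shows "g a \<in> data_law c nu Q n a \<rightarrow>\<^sub>M N"
  unfolding measurable_cong_sets[OF data_law_space(2)[OF assms(3,1)] refl]
  using measurable_compose[OF measurable_Pair1' assms(2), of a] assms(1)
  by (simp add: space_restrict_space)

text \<open>A real supremum bounds its members only if the family is bounded above; here
  \<open>(lchat + lc)\<^sup>2\<close> bounds all mean squared errors. The clipped estimate inherits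
  the bound because it agrees with \<open>est\<close> almost surely.\<close>

lemma clipped_error:
  assumes n: "1 \<le> n" and a: "a \<in> X"
  shows "(\<integral>\<^sup>+D. ennreal ((mat_norm (clipped n a D - jacobian c (at a)))\<^sup>2) \<partial>data_law c nu Q n a)
    \<le> ennreal ((e1 X c nu Q est n)\<^sup>2)"
proof -
  let ?err = "\<lambda>z D. (mat_norm (est n z D - jacobian c (at z)))\<^sup>2"
  have err: "integrable (data_law c nu Q n z) (?err z)"
    "(\<integral>D. ?err z D \<partial>data_law c nu Q n z) \<le> (lchat + lc)\<^sup>2" if z: "z \<in> X" for z
  proof -
    interpret D: prob_space "data_law c nu Q n z" by (rule data_law_space[OF n z])
    have [measurable]: "est n z \<in> borel_measurable (data_law c nu Q n z)"
      by (rule data_section[OF z est_measurable[OF n] n])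
    have "AE D in data_law c nu Q n z. mat_norm (est n z D) \<le> lchat" using est_bound n z by blast
    then have ae: "AE D in data_law c nu Q n z. ?err z D \<le> (lchat + lc)\<^sup>2"
    proof eventually_elim
      fix D assume "mat_norm (est n z D) \<le> lchat"
      then have "mat_norm (est n z D - jacobian c (at z)) \<le> lchat + lc"
        using mat_norm_diff[of "est n z D" "jacobian c (at z)"] mat_norm_jacobian_le[OF XU[OF z]] by simp
      then show "?err z D \<le> (lchat + lc)\<^sup>2" by (rule power_mono[OF _ mat_norm_nonneg])
    qed
    show int: "integrable (data_law c nu Q n z) (?err z)"
      by (rule D.integrable_const_bound[where B="(lchat + lc)\<^sup>2"]) (use ae in simp_all)
    show "(\<integral>D. ?err z D \<partial>data_law c nu Q n z) \<le> (lchat + lc)\<^sup>2"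
      by (rule D.integral_le_const[OF int ae])
  qed
  let ?I = "\<integral>D. ?err a D \<partial>data_law c nu Q n a"
  have "sqrt ?I \<le> e1 X c nu Q est n"
    unfolding e1_def
  proof (rule cSUP_upper[OF a])
    show "bdd_above ((\<lambda>z. sqrt (\<integral>D. ?err z D \<partial>data_law c nu Q n z)) ` X)"
      by (rule bdd_aboveI2[where M="sqrt ((lchat + lc)\<^sup>2)"]) (rule real_sqrt_le_mono, rule err(2))
  qed
  then have "(sqrt ?I)\<^sup>2 \<le> (e1 X c nu Q est n)\<^sup>2" by (rule power_mono) simp
  then have I: "?I \<le> (e1 X c nu Q est n)\<^sup>2" by simp
  have "AE D in data_law c nu Q n a. mat_norm (est n a D) \<le> lchat" using est_bound n a by blast
  then have "(\<integral>\<^sup>+D. ennreal ((mat_norm (clipped n a D - jacobian c (at a)))\<^sup>2) \<partial>data_law c nu Q n a)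
      = (\<integral>\<^sup>+D. ennreal (?err a D) \<partial>data_law c nu Q n a)"
    by (intro nn_integral_cong_AE) (auto simp: clipped_def elim: eventually_mono)
  also have "\<dots> = ennreal ?I" by (rule nn_integral_eq_integral[OF err(1)[OF a]]) simp
  finally show ?thesis using I by (simp add: ennreal_leI)
qed

lemma step_measurable:
  assumes "1 \<le> m" "al > rho + lphi * Lc" "1 \<le> n"
  shows "(\<lambda>(a, w, D). model_prox m al w (clipped n a D) a)
    \<in> restrict_space borel X \<Otimes>\<^sub>M (PiM {..<m} (\<lambda>_. borel) \<Otimes>\<^sub>M PiM {..<n} (\<lambda>_. borel))
      \<rightarrow>\<^sub>M restrict_space borel X" (is "_ \<in> ?N \<rightarrow>\<^sub>M _")
proof -
  have "(\<lambda>v. model_prox m al (fst (snd v)) (clipped n (fst v) (snd (snd v))) (fst v))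
      \<in> ?N \<rightarrow>\<^sub>M restrict_space borel X"
  proof (rule model_prox_measurable[OF assms(1,2)])
    have "fst \<in> ?N \<rightarrow>\<^sub>M restrict_space borel X" by simp
    then show "fst \<in> borel_measurable ?N" by (rule measurable_compose[OF _ ident_measurable])
    show "v \<in> space ?N \<Longrightarrow> fst v \<in> X" for v
      by (auto simp: space_pair_measure space_restrict_space)
    have "(\<lambda>v. (fst v, snd (snd v))) \<in> ?N \<rightarrow>\<^sub>M restrict_space borel X \<Otimes>\<^sub>M PiM {..<n} (\<lambda>_. borel)"
      by simp
    from measurable_compose[OF this clipped_measurable[OF assms(3)]]
    show "(\<lambda>v. clipped n (fst v) (snd (snd v))) \<in> borel_measurable ?N" by simp
    show "mat_norm (clipped n (fst v) (snd (snd v))) \<le> lchat" for v by (rule clipped_le)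
    fix i assume "i < m"
    then have "(\<lambda>w. w i) \<in> PiM {..<m} (\<lambda>_. borel) \<rightarrow>\<^sub>M borel"
      by (intro measurable_component_singleton) simp
    moreover have "(\<lambda>v. fst (snd v)) \<in> ?N \<rightarrow>\<^sub>M PiM {..<m} (\<lambda>_. borel)" by simp
    ultimately show "(\<lambda>v. fst (snd v) i) \<in> borel_measurable ?N"
      by (rule measurable_compose[rotated])
  qed
  then show ?thesis by (simp add: case_prod_beta')
qed

text \<open>For a frozen data set the descent bound is affine in the squared Jacobian error, so
  averaging over data sets requires its second moment only.\<close>

lemma one_step:
  assumes m: "1 \<le> m" and al: "al > rho + lphi * Lc" and n: "1 \<le> n" and a: "a \<in> X"
  shows "(\<integral>\<^sup>+y. ennreal (gap (model_prox m al (fst y) (clipped n a (snd y)) a))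
        \<partial>(batch_law c nu m a \<Otimes>\<^sub>M data_law c nu Q n a))
      + ennreal (rho * (2 * rho - lphi * Lc - tau) / (4 * (al + rho - tau)) * (norm (target a - a))\<^sup>2)
    \<le> ennreal (gap a + rho / (al + rho - tau) * noise al m n)" (is "_ + ennreal ?cr \<le> _")
proof -
  let ?W = "batch_law c nu m a" and ?D = "data_law c nu Q n a"
  let ?k = "rho / (al + rho - tau)" and ?st = "2 * lphi\<^sup>2 * (1 + lchat)\<^sup>2 / (real m * (al - lamh))"
  let ?C = "lphi\<^sup>2 / (2 * rho - lphi * Lc - tau) + lphi\<^sup>2 / (2 * (al - rho - lphi * Lc))"
  let ?d = "\<lambda>D. (mat_norm (clipped n a D - jacobian c (at a)))\<^sup>2"
  let ?h = "\<lambda>y. ennreal (gap (model_prox m al (fst y) (clipped n a (snd y)) a))"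
  note al' = step_constants[OF al]
  interpret W: prob_space ?W by (rule batch_law_space)
  interpret D: prob_space ?D by (rule data_law_space[OF n a])
  interpret WD: pair_sigma_finite ?W ?D ..
  have k: "0 \<le> ?k" using al'(4) constants(4) by simp
  have C: "0 \<le> ?C" using al'(3) constants(6) by simp
  have st: "0 \<le> ?st" using al'(2) by simp
  have split: "ennreal ((gap a + ?k * ?st) + (?k * ?C) * x) = ennreal (gap a + ?k * ?st) + ennreal (?k * ?C) * ennreal x"
    if "0 \<le> x" for x
  proof -
    have "0 \<le> gap a + ?k * ?st" by (intro add_nonneg_nonneg mult_nonneg_nonneg k st gap_nonneg a)
    moreover have "0 \<le> ?k * ?C" by (intro mult_nonneg_nonneg k C)
    ultimately show ?thesis using that by (simp only: ennreal_plus ennreal_mult mult_nonneg_nonneg)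
  qed
  have sets_eq: "sets (?W \<Otimes>\<^sub>M ?D) = sets (PiM {..<m} (\<lambda>_. borel) \<Otimes>\<^sub>M PiM {..<n} (\<lambda>_. borel))"
    by (intro sets_pair_measure_cong batch_law_space data_law_space n a)
  have "(\<lambda>y. model_prox m al (fst y) (clipped n a (snd y)) a) \<in> ?W \<Otimes>\<^sub>M ?D \<rightarrow>\<^sub>M restrict_space borel X"
    unfolding measurable_cong_sets[OF sets_eq refl]
    using measurable_compose[OF measurable_Pair1' step_measurable[OF m al n], of a] a
    by (simp add: space_restrict_space case_prod_beta')
  from measurable_compose[OF this gap_measurable]
  have h_meas: "?h \<in> borel_measurable (?W \<Otimes>\<^sub>M ?D)" by simp
  have d_meas: "?d \<in> borel_measurable ?D"
    using data_section[OF a clipped_measurable[OF n] n] by measurable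
  have inner: "(\<integral>\<^sup>+w. ?h (w, D) \<partial>?W) + ennreal ?cr \<le> ennreal (gap a + ?k * ?st) + ennreal (?k * ?C) * ennreal (?d D)" for D
  proof -
    have "(\<integral>\<^sup>+w. ?h (w, D) \<partial>?W) + ennreal ?cr \<le> ennreal ((gap a + ?k * ?st) + (?k * ?C) * ?d D)"
      using batch_descent[OF m al a clipped_le, of n a D]
      by (simp add: power_mult_distrib algebra_simps)
    also have "\<dots> = ennreal (gap a + ?k * ?st) + ennreal (?k * ?C) * ennreal (?d D)"
      by (rule split) simp
    finally show ?thesis .
  qed
  have "(\<integral>\<^sup>+y. ?h y \<partial>(?W \<Otimes>\<^sub>M ?D)) + ennreal ?cr
      = (\<integral>\<^sup>+D. (\<integral>\<^sup>+w. ?h (w, D) \<partial>?W) \<partial>?D) + ennreal ?cr"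
    by (subst WD.nn_integral_snd[OF h_meas, symmetric]) simp
  also have "\<dots> = (\<integral>\<^sup>+D. (\<integral>\<^sup>+w. ?h (w, D) \<partial>?W) + ennreal ?cr \<partial>?D)"
    using W.borel_measurable_nn_integral_fst[of "\<lambda>(D, w). ?h (w, D)" ?D]
      measurable_compose[OF measurable_pair_swap' h_meas]
    by (subst nn_integral_add) (simp_all add: D.emeasure_space_1 case_prod_beta')
  also have "\<dots> \<le> (\<integral>\<^sup>+D. ennreal (gap a + ?k * ?st) + ennreal (?k * ?C) * ennreal (?d D) \<partial>?D)"
    by (intro nn_integral_mono inner)
  also have "\<dots> = ennreal (gap a + ?k * ?st) + ennreal (?k * ?C) * (\<integral>\<^sup>+D. ennreal (?d D) \<partial>?D)"
    using d_meas by (simp add: nn_integral_add nn_integral_cmult D.emeasure_space_1)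
  also have "\<dots> \<le> ennreal (gap a + ?k * ?st) + ennreal (?k * ?C) * ennreal ((e1 X c nu Q est n)\<^sup>2)"
    by (intro add_left_mono mult_left_mono clipped_error n a) simp
  also have "\<dots> = ennreal ((gap a + ?k * ?st) + (?k * ?C) * (e1 X c nu Q est n)\<^sup>2)"
    by (rule split[symmetric]) simp
  also have "(gap a + ?k * ?st) + (?k * ?C) * (e1 X c nu Q est n)\<^sup>2 = gap a + ?k * noise al m n"
    unfolding noise_def by (simp add: algebra_simps)
  finally show ?thesis .
qed

end

section \<open>Expected descent along a run\<close>

lemma space_past_samples: "space (past_samples M m n eta S t) = space M"
  unfolding past_samples_def by (rule space_measure_of) auto

lemma sets_past_samples:
  "sets (past_samples M m n eta S t) = sigma_sets (space M)
     (\<Union>s<t. (\<Union>i<m s. {eta s i -` A \<inter> space M | A. A \<in> sets borel}) \<union>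
             (\<Union>i<n s. {S s i -` A \<inter> space M | A. A \<in> sets borel}))"
  unfolding past_samples_def by (rule sets_measure_of) auto

lemma subalgebra_past_samples:
  assumes "\<And>s i. s < t \<Longrightarrow> i < m s \<Longrightarrow> eta s i \<in> M \<rightarrow>\<^sub>M borel"
    and "\<And>s i. s < t \<Longrightarrow> i < n s \<Longrightarrow> S s i \<in> M \<rightarrow>\<^sub>M borel"
  shows "subalgebra M (past_samples M m n eta S t)"
  unfolding subalgebra_def space_past_samples sets_past_samples
  using assms by (intro conjI refl sets.sigma_sets_subset) (auto intro: measurable_sets)

lemma subalgebra_past_samples_mono:
  "s \<le> t \<Longrightarrow> subalgebra (past_samples M m n eta S t) (past_samples M m n eta S s)"
  unfolding subalgebra_def space_past_samples sets_past_samples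
  by (intro conjI refl sigma_sets_mono' UN_mono) auto

text \<open>Telescoping is done without subtraction, since terms of type \<open>ennreal\<close> may
  be infinite and cannot be cancelled.\<close>

lemma ennreal_telescope:
  fixes A B D :: "nat \<Rightarrow> ennreal"
  assumes "\<And>t. t < k \<Longrightarrow> A (Suc t) + B t \<le> A t + D t"
  shows "A k + (\<Sum>t<k. B t) \<le> A 0 + (\<Sum>t<k. D t)"
  using assms
proof (induction k)
  case (Suc k)
  have "A (Suc k) + (\<Sum>t<Suc k. B t) = (A (Suc k) + B k) + (\<Sum>t<k. B t)"
    by (simp add: ac_simps)
  also have "\<dots> \<le> (A k + D k) + (\<Sum>t<k. B t)"
    using Suc.prems[of k] by (intro add_right_mono) simp
  also have "\<dots> = (A k + (\<Sum>t<k. B t)) + D k" by (simp add: ac_simps)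
  also have "\<dots> \<le> (A 0 + (\<Sum>t<k. D t)) + D k"
    using Suc by (intro add_right_mono) simp
  finally show ?case by (simp add: ac_simps)
qed simp

locale lspl = spl_algorithm X U phi c nu lam lphi lc Lc lchat lamt lamh tau rho zmin Q est + prob_space M
  for X U :: "(real^'d) set"
    and phi :: "(real^'d) \<times> (real^'l) \<Rightarrow> real"
    and c :: "real^'d \<Rightarrow> real^'l"
    and nu :: "(real^'l) measure"
    and lam lphi lc Lc lchat lamt lamh tau rho :: real
    and zmin :: "real^'d"
    and Q :: "nat \<Rightarrow> real^'d \<Rightarrow> (real^'d) measure"
    and est :: "nat \<Rightarrow> real^'d \<Rightarrow> (nat \<Rightarrow> (real^'d) \<times> (real^'l)) \<Rightarrow> real^'d^'l"
    and M :: "'a measure" +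
  fixes T :: nat and m n :: "nat \<Rightarrow> nat" and alpha :: "nat \<Rightarrow> real"
    and z0 :: "real^'d"
    and eta :: "nat \<Rightarrow> nat \<Rightarrow> 'a \<Rightarrow> real^'l"
    and S :: "nat \<Rightarrow> nat \<Rightarrow> 'a \<Rightarrow> (real^'d) \<times> (real^'l)"
    and z :: "nat \<Rightarrow> 'a \<Rightarrow> real^'d"
  assumes alpha: "\<forall>t\<le>T. alpha t > rho + lphi * Lc"
    and z0: "z0 \<in> X"
    and sizes: "\<forall>t\<le>T. 1 \<le> m t \<and> 1 \<le> n t"
    and run: "lspl_run M X phi c nu Q est m n alpha T z0 eta S z"
begin

abbreviation past :: "nat \<Rightarrow> 'a measure" where "past \<equiv> past_samples M m n eta S"

definition samples :: "nat \<Rightarrow> 'a \<Rightarrow> (nat \<Rightarrow> real^'l) \<times> (nat \<Rightarrow> (real^'d) \<times> (real^'l))" where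
  "samples t \<omega> = (\<lambda>i\<in>{..<m t}. eta t i \<omega>, \<lambda>i\<in>{..<n t}. S t i \<omega>)"

definition residual :: "nat \<Rightarrow> 'a \<Rightarrow> real" where
  "residual t \<omega> = norm (target (z t \<omega>) - z t \<omega>)"

lemma run_measurable:
  "t \<le> T \<Longrightarrow> i < m t \<Longrightarrow> eta t i \<in> M \<rightarrow>\<^sub>M borel" "t \<le> T \<Longrightarrow> i < n t \<Longrightarrow> S t i \<in> M \<rightarrow>\<^sub>M borel"
  "t \<le> Suc T \<Longrightarrow> z t \<in> past t \<rightarrow>\<^sub>M restrict_space borel X"
  using run unfolding lspl_run_def by auto

lemma past_subalgebra: "t \<le> Suc T \<Longrightarrow> subalgebra M (past t)"
  by (rule subalgebra_past_samples) (auto intro: run_measurable)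

lemma iterate_measurable: "t \<le> Suc T \<Longrightarrow> z t \<in> M \<rightarrow>\<^sub>M restrict_space borel X"
  by (rule measurable_from_subalg[OF past_subalgebra run_measurable(3)])

lemma iterate_in: "t \<le> Suc T \<Longrightarrow> \<omega> \<in> space M \<Longrightarrow> z t \<omega> \<in> X"
  using measurable_space[OF iterate_measurable] by (simp add: space_restrict_space)

text \<open>All residuals are placed on the single sigma-algebra \<open>past (Suc T)\<close>, the
  one from which the random index is independent.\<close>

lemma residual_measurable: "t \<le> Suc T \<Longrightarrow> residual t \<in> borel_measurable (past (Suc T))"
proof -
  assume t: "t \<le> Suc T"
  have z: "z t \<in> past (Suc T) \<rightarrow>\<^sub>M restrict_space borel X"
    by (rule measurable_from_subalg[OF subalgebra_past_samples_mono[OF t] run_measurable(3)[OF t]])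
  note [measurable] = target_measurable ident_measurable
  have "(\<lambda>a. norm (target a - a)) \<in> borel_measurable (restrict_space borel X)" by measurable
  from measurable_compose[OF z this] show ?thesis by (simp add: residual_def[abs_def])
qed

lemma samples_measurable:
  assumes t: "t \<le> T"
  shows "samples t \<in> M \<rightarrow>\<^sub>M PiM {..<m t} (\<lambda>_. borel) \<Otimes>\<^sub>M PiM {..<n t} (\<lambda>_. borel)"
  unfolding samples_def[abs_def]
  by (intro measurable_Pair measurable_restrict run_measurable t) auto

lemma nn_integral_samples:
  assumes t: "t \<le> T"
    and H: "H \<in> borel_measurable (restrict_space borel X
      \<Otimes>\<^sub>M (PiM {..<m t} (\<lambda>_. borel) \<Otimes>\<^sub>M PiM {..<n t} (\<lambda>_. borel)))"
  shows "(\<integral>\<^sup>+\<omega>. H (z t \<omega>, samples t \<omega>) \<partial>M)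
    = (\<integral>\<^sup>+\<omega>. (\<integral>\<^sup>+y. H (z t \<omega>, y) \<partial>(batch_law c nu (m t) (z t \<omega>) \<Otimes>\<^sub>M data_law c nu Q (n t) (z t \<omega>))) \<partial>M)"
    and "(\<lambda>\<omega>. \<integral>\<^sup>+y. H (z t \<omega>, y) \<partial>(batch_law c nu (m t) (z t \<omega>) \<Otimes>\<^sub>M data_law c nu Q (n t) (z t \<omega>)))
      \<in> borel_measurable M"
proof -
  have K: "(\<lambda>a. batch_law c nu (m t) a \<Otimes>\<^sub>M data_law c nu Q (n t) a) \<in> restrict_space borel X
      \<rightarrow>\<^sub>M prob_algebra (PiM {..<m t} (\<lambda>_. borel) \<Otimes>\<^sub>M PiM {..<n t} (\<lambda>_. borel))"
    using sizes t
    by (intro measurable_pair_prob data_law_kernel measurable_restrict_space1 batch_law_kernel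
        nu(1,2) c_meas design) auto
  show "(\<integral>\<^sup>+\<omega>. H (z t \<omega>, samples t \<omega>) \<partial>M)
    = (\<integral>\<^sup>+\<omega>. (\<integral>\<^sup>+y. H (z t \<omega>, y) \<partial>(batch_law c nu (m t) (z t \<omega>) \<Otimes>\<^sub>M data_law c nu Q (n t) (z t \<omega>))) \<partial>M)"
  proof (rule nn_integral_kernel[OF prob_space_axioms past_subalgebra run_measurable(3) samples_measurable[OF t] K _ H])
    fix A :: "((nat \<Rightarrow> real^'l) \<times> (nat \<Rightarrow> (real^'d) \<times> (real^'l))) set"
    assume "A \<in> sets (PiM {..<m t} (\<lambda>_. borel) \<Otimes>\<^sub>M PiM {..<n t} (\<lambda>_. borel))"
    then show "AE \<omega> in M. real_cond_exp M (past t) (\<lambda>\<omega>'. indicator A (samples t \<omega>')) \<omega>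
        = measure (batch_law c nu (m t) (z t \<omega>) \<Otimes>\<^sub>M data_law c nu Q (n t) (z t \<omega>)) A"
      using run t unfolding lspl_run_def samples_def by blast
  qed (use t in auto)
  have "(\<lambda>a. \<integral>\<^sup>+y. H (a, y) \<partial>(batch_law c nu (m t) a \<Otimes>\<^sub>M data_law c nu Q (n t) a))
      \<in> borel_measurable (restrict_space borel X)"
    by (rule nn_integral_measurable_subprob_algebra2[OF _ measurable_prob_algebraD[OF K]])
      (use H in \<open>simp add: case_prod_beta'\<close>)
  from measurable_compose[OF iterate_measurable this] t
  show "(\<lambda>\<omega>. \<integral>\<^sup>+y. H (z t \<omega>, y) \<partial>(batch_law c nu (m t) (z t \<omega>) \<Otimes>\<^sub>M data_law c nu Q (n t) (z t \<omega>)))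
      \<in> borel_measurable M"
    by simp
qed

text \<open>The bound on the estimate is assumed at fixed points, whereas the iterate is random.
  Integrating the indicator of a violation against the conditional law transfers it: the inner
  integral vanishes at every value of the iterate.\<close>

lemma estimate_bounded:
  assumes t: "t \<le> T"
  shows "AE \<omega> in M. mat_norm (est (n t) (z t \<omega>) (snd (samples t \<omega>))) \<le> lchat"
proof -
  let ?N = "restrict_space borel X \<Otimes>\<^sub>M (PiM {..<m t} (\<lambda>_. borel) \<Otimes>\<^sub>M PiM {..<n t} (\<lambda>_. borel))"
  let ?H = "\<lambda>(a, y). indicator {lchat<..} (mat_norm (est (n t) a (snd y))) :: ennreal"
  have nt: "1 \<le> n t" using sizes t by blast
  have proj: "(\<lambda>v. (fst v, snd (snd v))) \<in> ?N \<rightarrow>\<^sub>M restrict_space borel X \<Otimes>\<^sub>M PiM {..<n t} (\<lambda>_. borel)"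
    by simp
  have [measurable]: "(\<lambda>v. est (n t) (fst v) (snd (snd v))) \<in> borel_measurable ?N"
    using measurable_compose[OF proj est_measurable[OF nt]] by simp
  have H: "?H \<in> borel_measurable ?N"
    unfolding case_prod_beta' by measurable
  have zero: "(\<integral>\<^sup>+y. ?H (a, y) \<partial>(batch_law c nu (m t) a \<Otimes>\<^sub>M data_law c nu Q (n t) a)) = 0" if a: "a \<in> X" for a
  proof -
    let ?W = "batch_law c nu (m t) a" and ?D = "data_law c nu Q (n t) a"
    interpret W: prob_space ?W by (rule batch_law_space)
    interpret D: prob_space ?D by (rule data_law_space[OF nt a])
    interpret WD: pair_sigma_finite ?W ?D ..
    have [measurable]: "est (n t) a \<in> borel_measurable ?D"
      by (rule data_section[OF a est_measurable[OF nt] nt])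
    have "(\<integral>\<^sup>+y. ?H (a, y) \<partial>(?W \<Otimes>\<^sub>M ?D)) = (\<integral>\<^sup>+D. (\<integral>\<^sup>+w. ?H (a, (w, D)) \<partial>?W) \<partial>?D)"
      by (rule WD.nn_integral_snd[symmetric]) simp
    also have "\<dots> = (\<integral>\<^sup>+D. indicator {lchat<..} (mat_norm (est (n t) a D)) \<partial>?D)"
      by (simp add: W.emeasure_space_1)
    also have "\<dots> = 0"
    proof (subst nn_integral_0_iff_AE)
      show "AE D in ?D. indicator {lchat<..} (mat_norm (est (n t) a D)) = (0 :: ennreal)"
        using est_bound[rule_format, OF nt a] by eventually_elim (simp add: indicator_def)
    qed simp
    finally show ?thesis .
  qed
  have "(\<integral>\<^sup>+\<omega>. ?H (z t \<omega>, samples t \<omega>) \<partial>M) = (\<integral>\<^sup>+\<omega>. 0 \<partial>M)"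
    unfolding nn_integral_samples(1)[OF t H]
    by (intro nn_integral_cong zero iterate_in) (use t in auto)
  moreover have "(\<lambda>\<omega>. (z t \<omega>, samples t \<omega>)) \<in> M \<rightarrow>\<^sub>M ?N"
    using iterate_measurable[of t] samples_measurable[OF t] t by (intro measurable_Pair) simp_all
  from measurable_compose[OF this H] have "(\<lambda>\<omega>. ?H (z t \<omega>, samples t \<omega>)) \<in> borel_measurable M" .
  ultimately have "AE \<omega> in M. ?H (z t \<omega>, samples t \<omega>) = 0"
    by (simp only: nn_integral_0_iff_AE nn_integral_const mult_zero_left)
  then show ?thesis by eventually_elim (auto simp: indicator_def not_less split: if_splits)
qed

text \<open>Almost surely no clipping occurs; the subproblem is then strongly convex, so the
  minimiser taken by the run is the one selected by \<open>model_prox\<close>.\<close>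

lemma next_iterate:
  assumes t: "t \<le> T"
  shows "AE \<omega> in M. z (Suc t) \<omega>
    = model_prox (m t) (alpha t) (fst (samples t \<omega>)) (clipped (n t) (z t \<omega>) (snd (samples t \<omega>))) (z t \<omega>)"
proof -
  have mt: "1 \<le> m t" and al: "alpha t > rho + lphi * Lc" using sizes alpha t by blast+
  have "AE \<omega> in M. is_arg_min
      (\<lambda>x. empirical_model phi (m t) (\<lambda>i. eta t i \<omega>)
              (est (n t) (z t \<omega>) (\<lambda>i\<in>{..<n t}. S t i \<omega>)) (z t \<omega>) x
            + alpha t / 2 * (norm (x - z t \<omega>))\<^sup>2)
      (\<lambda>x. x \<in> X) (z (Suc t) \<omega>)"
    using run t unfolding lspl_run_def by blast
  with estimate_bounded[OF t] AE_space show ?thesis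
  proof eventually_elim
    case (elim \<omega>)
    let ?A = "clipped (n t) (z t \<omega>) (snd (samples t \<omega>))"
    have A: "est (n t) (z t \<omega>) (\<lambda>i\<in>{..<n t}. S t i \<omega>) = ?A"
      using elim(1) by (simp add: clipped_def samples_def)
    \<comment> \<open>The model reads the batch at indices below \<open>m t\<close> only, so the
      default value outside the restriction is immaterial.\<close>
    have "empirical_model phi (m t) (\<lambda>i. eta t i \<omega>) ?A (z t \<omega>)
        = empirical_model phi (m t) (fst (samples t \<omega>)) ?A (z t \<omega>)"
      by (auto simp: empirical_model_def samples_def intro!: ext)
    with elim(3) have "is_arg_min
        (\<lambda>x. empirical_model phi (m t) (fst (samples t \<omega>)) ?A (z t \<omega>) x + alpha t / 2 * (norm (x - z t \<omega>))\<^sup>2)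
        (\<lambda>x. x \<in> X) (z (Suc t) \<omega>)"
      by (simp add: A)
    from is_arg_min_unique[OF empirical_weakly_convex[OF mt al clipped_le] step_constants(2)[OF al] this
        model_prox_min[OF mt al iterate_in clipped_le]] t elim(2)
    show ?case by simp
  qed
qed

lemma expected_descent:
  assumes t: "t \<le> T"
  shows "(\<integral>\<^sup>+\<omega>. ennreal (gap (z (Suc t) \<omega>)) \<partial>M)
      + ennreal (rho * (2 * rho - lphi * Lc - tau) / (4 * (alpha t + rho - tau)))
        * (\<integral>\<^sup>+\<omega>. ennreal ((residual t \<omega>)\<^sup>2) \<partial>M)
    \<le> (\<integral>\<^sup>+\<omega>. ennreal (gap (z t \<omega>)) \<partial>M)
      + ennreal (rho / (alpha t + rho - tau) * noise (alpha t) (m t) (n t))"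
    (is "_ + ennreal ?c * _ \<le> _ + ennreal ?e")
proof -
  let ?K = "\<lambda>a. batch_law c nu (m t) a \<Otimes>\<^sub>M data_law c nu Q (n t) a"
  let ?H = "\<lambda>(a, y). ennreal (gap (model_prox (m t) (alpha t) (fst y) (clipped (n t) a (snd y)) a))"
  have mt: "1 \<le> m t" and nt: "1 \<le> n t" and al: "alpha t > rho + lphi * Lc" using sizes alpha t by blast+
  note al' = step_constants[OF al]
  have c: "0 \<le> ?c" using al'(4) constants(4,6) by simp
  have e: "0 \<le> ?e"
    unfolding noise_def using al' constants(4,6)
    by (intro mult_nonneg_nonneg add_nonneg_nonneg divide_nonneg_nonneg) auto
  have H: "?H \<in> borel_measurable (restrict_space borel X
      \<Otimes>\<^sub>M (PiM {..<m t} (\<lambda>_. borel) \<Otimes>\<^sub>M PiM {..<n t} (\<lambda>_. borel)))"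
    using measurable_compose[OF step_measurable[OF mt al nt] gap_measurable]
    by (simp add: case_prod_beta')
  have r_meas: "residual t \<in> borel_measurable M"
    using measurable_from_subalg[OF past_subalgebra residual_measurable] t by simp
  have gap_meas: "(\<lambda>\<omega>. gap (z t \<omega>)) \<in> borel_measurable M"
    using measurable_compose[OF iterate_measurable gap_measurable] t by simp
  have "(\<integral>\<^sup>+\<omega>. ennreal (gap (z (Suc t) \<omega>)) \<partial>M) = (\<integral>\<^sup>+\<omega>. ?H (z t \<omega>, samples t \<omega>) \<partial>M)"
    using next_iterate[OF t] by (intro nn_integral_cong_AE) (auto elim: eventually_mono)
  also have "\<dots> = (\<integral>\<^sup>+\<omega>. (\<integral>\<^sup>+y. ?H (z t \<omega>, y) \<partial>?K (z t \<omega>)) \<partial>M)"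
    by (rule nn_integral_samples(1)[OF t H])
  finally have "(\<integral>\<^sup>+\<omega>. ennreal (gap (z (Suc t) \<omega>)) \<partial>M) + ennreal ?c * (\<integral>\<^sup>+\<omega>. ennreal ((residual t \<omega>)\<^sup>2) \<partial>M)
      = (\<integral>\<^sup>+\<omega>. (\<integral>\<^sup>+y. ?H (z t \<omega>, y) \<partial>?K (z t \<omega>)) \<partial>M) + (\<integral>\<^sup>+\<omega>. ennreal (?c * (residual t \<omega>)\<^sup>2) \<partial>M)"
    using r_meas by (subst nn_integral_cmult[symmetric]) (simp, simp only: ennreal_mult[OF c zero_le_power2])
  also have "\<dots> = (\<integral>\<^sup>+\<omega>. (\<integral>\<^sup>+y. ?H (z t \<omega>, y) \<partial>?K (z t \<omega>)) + ennreal (?c * (residual t \<omega>)\<^sup>2) \<partial>M)"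
    using r_meas by (intro nn_integral_add[symmetric] nn_integral_samples(2)[OF t H]) simp
  also have "\<dots> \<le> (\<integral>\<^sup>+\<omega>. ennreal (gap (z t \<omega>)) + ennreal ?e \<partial>M)"
  proof (rule nn_integral_mono)
    fix \<omega> assume w: "\<omega> \<in> space M"
    have a: "z t \<omega> \<in> X" by (rule iterate_in) (use t w in auto)
    show "(\<integral>\<^sup>+y. ?H (z t \<omega>, y) \<partial>?K (z t \<omega>)) + ennreal (?c * (residual t \<omega>)\<^sup>2)
        \<le> ennreal (gap (z t \<omega>)) + ennreal ?e"
      using one_step[OF mt al nt a]
      unfolding ennreal_plus[OF gap_nonneg[OF a] e, symmetric] residual_def by simp
  qed
  also have "\<dots> = (\<integral>\<^sup>+\<omega>. ennreal (gap (z t \<omega>)) \<partial>M) + ennreal ?e"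
    using gap_meas by (subst nn_integral_add) (simp_all add: emeasure_space_1)
  finally show ?thesis .
qed

lemma expected_residuals:
  "(\<Sum>t\<le>T. ennreal (rho * (2 * rho - lphi * Lc - tau) / (4 * (alpha t + rho - tau)))
        * (\<integral>\<^sup>+\<omega>. ennreal ((residual t \<omega>)\<^sup>2) \<partial>M))
    \<le> ennreal (gap z0 + (\<Sum>t\<le>T. rho / (alpha t + rho - tau) * noise (alpha t) (m t) (n t)))"
proof -
  let ?b = "\<lambda>t. ennreal (rho * (2 * rho - lphi * Lc - tau) / (4 * (alpha t + rho - tau)))
        * (\<integral>\<^sup>+\<omega>. ennreal ((residual t \<omega>)\<^sup>2) \<partial>M)"
  let ?e = "\<lambda>t. rho / (alpha t + rho - tau) * noise (alpha t) (m t) (n t)"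
  let ?g = "\<lambda>t. \<integral>\<^sup>+\<omega>. ennreal (gap (z t \<omega>)) \<partial>M"
  have e: "0 \<le> ?e t" if t: "t \<le> T" for t
  proof -
    have al: "alpha t > rho + lphi * Lc" using alpha t by blast
    show ?thesis
      unfolding noise_def using step_constants[OF al] constants(4,6)
      by (intro mult_nonneg_nonneg add_nonneg_nonneg divide_nonneg_nonneg) auto
  qed
  have "?g 0 = (\<integral>\<^sup>+\<omega>. ennreal (gap z0) \<partial>M)"
    using run by (intro nn_integral_cong) (simp add: lspl_run_def)
  then have g0: "?g 0 = ennreal (gap z0)" by (simp add: emeasure_space_1)
  \<comment> \<open>There are \<open>T + 1\<close> steps, the last of which produces
    \<open>z (Suc T)\<close>; its nonnegative gap is added for telescoping.\<close>
  have "(\<Sum>t<Suc T. ?b t) \<le> ?g (Suc T) + (\<Sum>t<Suc T. ?b t)" by simp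
  also have "\<dots> \<le> ?g 0 + (\<Sum>t<Suc T. ennreal (?e t))"
    by (rule ennreal_telescope) (rule expected_descent, simp)
  also have "\<dots> = ennreal (gap z0 + (\<Sum>t<Suc T. ?e t))"
  proof -
    have "(\<Sum>t<Suc T. ennreal (?e t)) = ennreal (\<Sum>t<Suc T. ?e t)" by (rule sum_ennreal) (use e in simp)
    moreover have "0 \<le> (\<Sum>t<Suc T. ?e t)" by (rule sum_nonneg) (use e in simp)
    ultimately show ?thesis by (simp only: g0 ennreal_plus[OF gap_nonneg[OF z0]])
  qed
  finally show ?thesis by (simp only: lessThan_Suc_atMost)
qed

section \<open>Averaging over the random output index\<close>

lemma random_index_residual:
  assumes tstar: "tstar \<in> M \<rightarrow>\<^sub>M count_space UNIV" "\<forall>\<omega>\<in>space M. tstar \<omega> \<le> T"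
    and indep: "indep_set {tstar -` A \<inter> space M | A. A \<in> UNIV} (sets (past (Suc T)))"
  shows "(\<lambda>\<omega>. residual (tstar \<omega>) \<omega>) \<in> borel_measurable M"
    and "(\<integral>\<^sup>+\<omega>. ennreal ((residual (tstar \<omega>) \<omega>)\<^sup>2) \<partial>M)
      = (\<Sum>t\<le>T. ennreal (prob {\<omega> \<in> space M. tstar \<omega> = t}) * (\<integral>\<^sup>+\<omega>. ennreal ((residual t \<omega>)\<^sup>2) \<partial>M))"
proof -
  let ?E = "\<lambda>t. {\<omega> \<in> space M. tstar \<omega> = t}"
  have E: "?E t = tstar -` {t} \<inter> space M" for t by auto
  have E_meas: "?E t \<in> sets M" for t
    unfolding E by (rule measurable_sets[OF tstar(1)]) simp
  have r_past: "residual t \<in> borel_measurable (past (Suc T))" if "t \<le> T" for t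
    using residual_measurable that by simp
  have r_meas: "residual t \<in> borel_measurable M" if "t \<le> T" for t
    by (rule measurable_from_subalg[OF past_subalgebra r_past[OF that]]) simp
  have split: "g (tstar \<omega>) = (\<Sum>t\<le>T. indicator (?E t) \<omega> * g t)" if "\<omega> \<in> space M"
    for \<omega> and g :: "nat \<Rightarrow> 'b :: semiring_1"
  proof -
    have "(\<Sum>t\<le>T. indicator (?E t) \<omega> * g t) = (\<Sum>t\<le>T. if t = tstar \<omega> then g t else 0)"
      using that by (intro sum.cong) (auto simp: indicator_def)
    then show ?thesis using tstar(2) that by simp
  qed
  have "(\<lambda>\<omega>. \<Sum>t\<le>T. indicator (?E t) \<omega> * residual t \<omega>) \<in> borel_measurable M"
    by (intro borel_measurable_sum borel_measurable_times borel_measurable_indicator E_meas r_meas) simp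
  then show "(\<lambda>\<omega>. residual (tstar \<omega>) \<omega>) \<in> borel_measurable M"
    by (rule measurable_cong[THEN iffD2, rotated]) (rule split)
  \<comment> \<open>On each event \<open>?E t\<close> the index is constant, so independence is
    applied to one fixed residual at a time.\<close>
  have "(\<integral>\<^sup>+\<omega>. ennreal ((residual (tstar \<omega>) \<omega>)\<^sup>2) \<partial>M)
      = (\<integral>\<^sup>+\<omega>. (\<Sum>t\<le>T. indicator (?E t) \<omega> * ennreal ((residual t \<omega>)\<^sup>2)) \<partial>M)"
    by (intro nn_integral_cong split)
  also have "\<dots> = (\<Sum>t\<le>T. \<integral>\<^sup>+\<omega>. indicator (?E t) \<omega> * ennreal ((residual t \<omega>)\<^sup>2) \<partial>M)"
    using r_meas E_meas by (intro nn_integral_sum borel_measurable_times borel_measurable_indicator) simp_all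
  also have "\<dots> = (\<Sum>t\<le>T. ennreal (prob (?E t)) * (\<integral>\<^sup>+\<omega>. ennreal ((residual t \<omega>)\<^sup>2) \<partial>M))"
  proof (intro sum.cong refl nn_integral_indep_indicator[OF past_subalgebra[OF order_refl] E_meas])
    fix t A assume "A \<in> sets (past (Suc T))"
    then show "prob (?E t \<inter> A) = prob (?E t) * prob A"
      by (intro indep_setD[OF indep]) (auto simp: E)
  next
    fix t assume "t \<in> {..T}"
    then show "(\<lambda>\<omega>. ennreal ((residual t \<omega>)\<^sup>2)) \<in> borel_measurable (past (Suc T))"
      using r_past[of t] by simp
  qed
  finally show "(\<integral>\<^sup>+\<omega>. ennreal ((residual (tstar \<omega>) \<omega>)\<^sup>2) \<partial>M)
      = (\<Sum>t\<le>T. ennreal (prob (?E t)) * (\<integral>\<^sup>+\<omega>. ennreal ((residual t \<omega>)\<^sup>2) \<partial>M))" .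
qed

lemma random_index_bound:
  assumes tstar: "tstar \<in> M \<rightarrow>\<^sub>M count_space UNIV" "\<forall>\<omega>\<in>space M. tstar \<omega> \<le> T"
    and indep: "indep_set {tstar -` A \<inter> space M | A. A \<in> UNIV} (sets (past (Suc T)))"
    and law: "\<forall>t\<le>T. prob {\<omega> \<in> space M. tstar \<omega> = t}
      = (1 / (alpha t + rho - tau)) / (\<Sum>s\<le>T. 1 / (alpha s + rho - tau))"
  shows "integrable M (\<lambda>\<omega>. residual (tstar \<omega>) \<omega>)"
    and "(\<integral>\<omega>. residual (tstar \<omega>) \<omega> \<partial>M)
      \<le> sqrt ((4 * gap z0 + (\<Sum>t\<le>T. rho / (alpha t + rho - tau) * (4 * noise (alpha t) (m t) (n t))))
        / (\<Sum>t\<le>T. rho * (2 * rho - lphi * Lc - tau) / (alpha t + rho - tau)))"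
proof -
  let ?N = "\<lambda>t. alpha t + rho - tau" and ?B = "2 * rho - lphi * Lc - tau"
  let ?R = "\<lambda>t. \<integral>\<^sup>+\<omega>. ennreal ((residual t \<omega>)\<^sup>2) \<partial>M"
  let ?V = "gap z0 + (\<Sum>t\<le>T. rho / ?N t * noise (alpha t) (m t) (n t))"
  let ?s = "\<Sum>s\<le>T. 1 / ?N s" and ?r = "\<lambda>\<omega>. residual (tstar \<omega>) \<omega>"
  \<comment> \<open>Multiplying the probability of \<open>t\<close> by \<open>c0\<close> cancels the
    normalisation \<open>?s\<close> and reproduces the weight of residual \<open>t\<close> in
    \<open>expected_residuals\<close>.\<close>
  define c0 where "c0 = rho * ?B / 4 * ?s"
  have N: "0 < ?N t" if "t \<le> T" for t using alpha that step_constants(4) by blast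
  have s: "0 < ?s" using N by (intro sum_pos) auto
  then have c0: "0 < c0" unfolding c0_def using constants(4,6) by simp
  have meas: "?r \<in> borel_measurable M" by (rule random_index_residual(1)[OF tstar indep])
  have "ennreal c0 * (\<integral>\<^sup>+\<omega>. ennreal ((?r \<omega>)\<^sup>2) \<partial>M)
      = (\<Sum>t\<le>T. ennreal c0 * (ennreal ((1 / ?N t) / ?s) * ?R t))"
    unfolding random_index_residual(2)[OF tstar indep] sum_distrib_left
    using law by (intro sum.cong) auto
  also have "\<dots> = (\<Sum>t\<le>T. ennreal (rho * ?B / (4 * ?N t)) * ?R t)"
  proof (rule sum.cong[OF refl])
    fix t assume "t \<in> {..T}"
    then have Nt: "0 < ?N t" using N by simp
    have "c0 * ((1 / ?N t) / ?s) = rho * ?B / (4 * ?N t)"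
      unfolding c0_def using s by simp
    then have "ennreal c0 * ennreal ((1 / ?N t) / ?s) = ennreal (rho * ?B / (4 * ?N t))"
      using c0 Nt s by (subst ennreal_mult[symmetric]) simp_all
    then show "ennreal c0 * (ennreal ((1 / ?N t) / ?s) * ?R t) = ennreal (rho * ?B / (4 * ?N t)) * ?R t"
      by (simp add: mult.assoc[symmetric])
  qed
  also have "\<dots> \<le> ennreal ?V" by (rule expected_residuals)
  finally have le: "ennreal c0 * (\<integral>\<^sup>+\<omega>. ennreal ((?r \<omega>)\<^sup>2) \<partial>M) \<le> ennreal ?V" .
  have "(\<integral>\<^sup>+\<omega>. ennreal ((?r \<omega>)\<^sup>2) \<partial>M)
      = ennreal (1 / c0) * (ennreal c0 * (\<integral>\<^sup>+\<omega>. ennreal ((?r \<omega>)\<^sup>2) \<partial>M))"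
    using c0 by (simp add: mult.assoc[symmetric] ennreal_mult[symmetric])
  also have "\<dots> \<le> ennreal (1 / c0) * ennreal ?V" by (intro mult_left_mono le) simp
  also have "\<dots> = ennreal (?V / c0)" using c0 by (simp add: ennreal_mult'[symmetric])
  finally have nn: "(\<integral>\<^sup>+\<omega>. ennreal ((?r \<omega>)\<^sup>2) \<partial>M) \<le> ennreal (?V / c0)" .
  \<comment> \<open>Integrability is a consequence of the finite bound on the extended second
    moment.\<close>
  have sq: "integrable M (\<lambda>\<omega>. (?r \<omega>)\<^sup>2)"
    using meas nn by (intro integrableI_nonneg) (auto simp: less_top[symmetric] top_unique)
  show int: "integrable M ?r" by (rule square_integrable_imp_integrable[OF meas sq])
  have "ennreal (\<integral>\<omega>. (?r \<omega>)\<^sup>2 \<partial>M) \<le> ennreal (?V / c0)"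
    using nn nn_integral_eq_integral[OF sq] by simp
  moreover have V: "0 \<le> ?V"
  proof (intro add_nonneg_nonneg gap_nonneg z0 sum_nonneg)
    fix t assume "t \<in> {..T}"
    then have al: "alpha t > rho + lphi * Lc" using alpha by blast
    show "0 \<le> rho / ?N t * noise (alpha t) (m t) (n t)"
      unfolding noise_def using step_constants[OF al] constants(4,6)
      by (intro mult_nonneg_nonneg add_nonneg_nonneg divide_nonneg_nonneg) auto
  qed
  ultimately have "(\<integral>\<omega>. (?r \<omega>)\<^sup>2 \<partial>M) \<le> ?V / c0" using c0 by simp
  \<comment> \<open>Jensen's inequality in the form that the variance is nonnegative.\<close>
  moreover have "(expectation ?r)\<^sup>2 \<le> (\<integral>\<omega>. (?r \<omega>)\<^sup>2 \<partial>M)"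
    using variance_positive[of ?r] variance_eq[OF int sq] by simp
  ultimately have "expectation ?r \<le> sqrt (?V / c0)" by (intro real_le_rsqrt) simp
  also have "?V / c0 = (4 * ?V) / (4 * c0)" by (rule mult_divide_mult_cancel_left[symmetric]) simp
  also have "4 * ?V = 4 * gap z0 + (\<Sum>t\<le>T. rho / ?N t * (4 * noise (alpha t) (m t) (n t)))"
    by (simp add: sum_distrib_left algebra_simps)
  also have "4 * c0 = (\<Sum>t\<le>T. rho * ?B / ?N t)"
  proof -
    have "4 * c0 = rho * ?B * ?s" by (simp add: c0_def)
    then show ?thesis by (simp only: sum_distrib_left times_divide_eq_right mult_1_right)
  qed
  finally show "expectation ?r \<le> sqrt ((4 * gap z0 + (\<Sum>t\<le>T. rho / ?N t * (4 * noise (alpha t) (m t) (n t))))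
        / (\<Sum>t\<le>T. rho * ?B / ?N t))" .
qed

end

theorem theorem2:
  fixes X U :: "(real^'d) set"
    and phi :: "(real^'d) \<times> (real^'l) \<Rightarrow> real"
    and c :: "real^'d \<Rightarrow> real^'l"
    and nu :: "(real^'l) measure"
    and lam lphi lc Lc lchat lamt lamh tau rho Delta0 :: real
    and Q :: "nat \<Rightarrow> real^'d \<Rightarrow> (real^'d) measure"
    and est :: "nat \<Rightarrow> real^'d \<Rightarrow> (nat \<Rightarrow> (real^'d) \<times> (real^'l)) \<Rightarrow> real^'d^'l"
    and M :: "'a measure"
    and T :: nat and m n :: "nat \<Rightarrow> nat" and alpha :: "nat \<Rightarrow> real"
    and z0 zmin :: "real^'d"
    and eta :: "nat \<Rightarrow> nat \<Rightarrow> 'a \<Rightarrow> real^'l"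
    and S :: "nat \<Rightarrow> nat \<Rightarrow> 'a \<Rightarrow> (real^'d) \<times> (real^'l)"
    and z :: "nat \<Rightarrow> 'a \<Rightarrow> real^'d"
    and tstar :: "'a \<Rightarrow> nat"
  assumes A1: "X \<noteq> {}" "closed X" "convex X" "open U" "convex U" "X \<subseteq> U"
    and A2: "0 \<le> lam" "weakly_convex_on (U \<times> UNIV) lam phi" "lphi-lipschitz_on (U \<times> UNIV) phi"
    and A3: "prob_space nu" "sets nu = sets borel"
            "integrable nu (\<lambda>e. (norm e)\<^sup>2)" "(\<integral>e. e \<partial>nu) = 0"
    and A4: "lc-lipschitz_on U c" "c differentiable_on U" "continuous_on U (\<lambda>x. jacobian c (at x))"
            "\<forall>x\<in>U. \<forall>y\<in>U. mat_norm (jacobian c (at x) - jacobian c (at y)) \<le> Lc * norm (x - y)"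
            "c \<in> borel_measurable borel"
    and design: "static_design X Q \<or> adaptive_design X Q"
    and estimator: "measurable_estimator X est"
    and B: "\<forall>k\<ge>1. \<forall>y\<in>X. AE D in data_law c nu Q k y. mat_norm (est k y D) \<le> lchat"
    and lamt: "lamt = lam * (1 + lc)\<^sup>2"
    and lamh: "lamh = lam * (1 + lchat)\<^sup>2"
    and tau: "tau = lphi * Lc + lamh + lamt"
    and rho: "rho > lphi * Lc + max lamt lamh"
    and alpha: "\<forall>t\<le>T. alpha t > rho + lphi * Lc"
    and zmin: "is_arg_min (objective phi c nu) (\<lambda>x. x \<in> X) zmin"
    and Delta0: "Delta0 = moreau X (objective phi c nu) rho z0 - objective phi c nu zmin"
    and M: "prob_space M"
    and z0: "z0 \<in> X"
    and sizes: "\<forall>t\<le>T. 1 \<le> m t \<and> 1 \<le> n t"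
    and run: "lspl_run M X phi c nu Q est m n alpha T z0 eta S z"
    and tstar: "tstar \<in> M \<rightarrow>\<^sub>M count_space UNIV" "\<forall>\<omega>\<in>space M. tstar \<omega> \<le> T"
    and tstar_indep:
      "prob_space.indep_set M {tstar -` A \<inter> space M | A. A \<in> UNIV}
         (sets (past_samples M m n eta S (Suc T)))"
    and tstar_law:
      "\<forall>t\<le>T. measure M {\<omega> \<in> space M. tstar \<omega> = t} =
         (1 / (alpha t + rho - tau)) / (\<Sum>s\<le>T. 1 / (alpha s + rho - tau))"
  shows
    "integrable M (\<lambda>\<omega>.
        norm (prox X (objective phi c nu) rho (z (tstar \<omega>) \<omega>) - z (tstar \<omega>) \<omega>)) \<and>
     (\<integral>\<omega>. norm (prox X (objective phi c nu) rho (z (tstar \<omega>) \<omega>) - z (tstar \<omega>) \<omega>) \<partial>M)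
     \<le> sqrt ((4 * Delta0 +
              (\<Sum>t\<le>T. rho / (alpha t + rho - tau) *
                 (8 * lphi\<^sup>2 * (1 + lchat)\<^sup>2 / (real (m t) * (alpha t - lamh))
                  + 4 * lphi\<^sup>2 * (e1 X c nu Q est (n t))\<^sup>2 / (2 * rho - lphi * Lc - tau)
                  + 2 * lphi\<^sup>2 * (e1 X c nu Q est (n t))\<^sup>2 / (alpha t - rho - lphi * Lc))))
             / (\<Sum>t\<le>T. rho * (2 * rho - lphi * Lc - tau) / (alpha t + rho - tau)))"
proof -
  interpret L: lspl X U phi c nu lam lphi lc Lc lchat lamt lamh tau rho zmin Q est M T m n alpha z0 eta S z
    by (intro lspl.intro spl_algorithm.intro spl_problem.intro spl_algorithm_axioms.intro lspl_axioms.intro)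
      (rule assms)+
  have residual: "norm (prox X (objective phi c nu) rho (z (tstar \<omega>) \<omega>) - z (tstar \<omega>) \<omega>)
      = L.residual (tstar \<omega>) \<omega>" for \<omega>
    by (simp add: L.residual_def L.target_def)
  have noise: "4 * L.noise al k j = 8 * lphi\<^sup>2 * (1 + lchat)\<^sup>2 / (real k * (al - lamh))
      + 4 * lphi\<^sup>2 * (e1 X c nu Q est j)\<^sup>2 / (2 * rho - lphi * Lc - tau)
      + 2 * lphi\<^sup>2 * (e1 X c nu Q est j)\<^sup>2 / (al - rho - lphi * Lc)" for al k j
  proof -
    have "4 * (2 * p * q / r + (p * e / b + p * e / (2 * d))) = 8 * p * q / r + 4 * p * e / b + 2 * p * e / d"
      for p q r e b d :: real
      by (simp add: distrib_left ac_simps)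
    then show ?thesis unfolding L.noise_def .
  qed
  have Delta: "Delta0 = L.gap z0" unfolding Delta0 L.gap_def ..
  show ?thesis
    unfolding residual Delta noise[symmetric]
    using L.random_index_bound[OF tstar tstar_indep tstar_law] by blast
qed

end
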